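(* For VASS-MDPs of dimension $2$ that are P-VASS-MDPs, each of the following problems is undecidable: the sure reachability problem, the almost-sure reachability problem, the limit-sure reachability problem, the sure repeated reachability problem, the almost-sure repeated reachability problem, and the limit-sure repeated reachability problem.
   Context: A VASS-MDP of dimension $d\ge 0$ is a tuple $S=\langle Q,Q_1,Q_P,T,\tau\rangle$ where $Q$ is a finite set of control states partitioned into $Q_1$ (states of Player 1) and $Q_P$ (probabilistic states), $T\subseteq Q\times\mathbb{Z}^d\times Q$ is a finite set of transitions, and $\tau:T\to\mathbb{N}_{>0}$ assigns positive integer weights. Configurations are pairs $\langle q,\mathbf{v}\rangle\in Q\times\mathbb{N}^d$. A transition $t=\langle q,\mathbf{z},q'\rangle$ is enabled in $\langle q,\mathbf{v}\rangle$ if $\mathbf{v}+\mathbf{z}\in\mathbb{N}^d$, and then leads to $t(\langle q,\mathbf{v}\rangle)=\langle q',\mathbf{v}+\mathbf{z}\rangle$. The induced (infinite-state) MDP $M_S=\langle C,C_1,C_P,\rightarrow,p\rangle$ has $C=Q\times\mathbb{N}^d$, $C_1=Q_1\times\mathbb{N}^d$, $C_P=Q_P\times\mathbb{N}^d$, $c\rightarrow c'$ iff $c'=t(c)$ for some transition $t$ enabled in $c$, and for $c\in C_P$ with at least one enabled transition, $p(c)(c')=\frac{\sum\{\tau(t)\mid t \text{ enabled in } c,\ t(c)=c'\}}{\sum\{\tau(t)\mid t\text{ enabled in } c\}}$. A configuration without successor is a deadlock. A play is a finite or infinite sequence $c_0c_1\cdots$ with $c_i\rightarrow c_{i+1}$.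 A strategy $\sigma$ of Player 1 maps each finite play ending in a non-deadlock configuration $c\in C_1$ to some $c'$ with $c\rightarrow c'$. $\mathrm{Outcome}(M_S,c,\sigma)$ is the set of maximal plays (infinite, or finite ending in a deadlock) from $c$ in which Player 1 moves according to $\sigma$; $c$ and $\sigma$ induce a probability measure $\mathbb{P}(M_S,c,\sigma,\cdot)$ on plays, with successors of probabilistic configurations chosen according to $p$. For $q_F\in Q$, $[\![\Diamond q_F]\!]$ is the set of plays visiting a configuration with control state $q_F$, and $[\![\Box\Diamond q_F]\!]$ the set of infinite plays visiting such configurations infinitely often. A P-VASS-MDP is a VASS-MDP in which every transition $\langle q,\mathbf{z},q'\rangle$ with $q\in Q_1$ has $\mathbf{z}=\mathbf{0}$ (only probabilistic transitions change counters). Given $S$, an initial configuration $c_0$ and $q_F\in Q$: the sure reachability problem asks whether there is $\sigma$ with $\mathrm{Outcome}(M_S,c_0,\sigma)\subseteq[\![\Diamond q_F]\!]$; the almost-sure reachability problem asks whether there is $\sigma$ with $\mathbb{P}(M_S,c_0,\sigma,[\![\Diamond q_F]\!])=1$; the limit-sure reachability problem asks whether $\sup_\sigma\mathbb{P}(M_S,c_0,\sigma,[\![\Diamond q_F]\!])=1$. The repeated reachability versions are the same with $[\![\Box\Diamond q_F]\!]$ instead of $[\![\Diamond q_F]\!]$. *)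

theory Defs
  imports "HOL-Probability.Probability" "HOL-Library.Nat_Bijection"
begin

section \<open>Decidability\<close>

text \<open>
  Decidability is expressed with Kleene's partial recursive functions. Arities are not tracked by the datatype: a term applied to an
  argument list of unsuitable length just has no value.
\<close>

datatype recf = Zero | Succ | Proj nat | Comp recf "recf list" | Prec recf recf | Mu recf

inductive evals_to :: "recf \<Rightarrow> nat list \<Rightarrow> nat \<Rightarrow> bool" where
  Zero: "evals_to Zero xs 0"
| Succ: "evals_to Succ [x] (Suc x)"
| Proj: "i < length xs \<Longrightarrow> evals_to (Proj i) xs (xs ! i)"
| Comp: "list_all2 (\<lambda>g y. evals_to g xs y) gs ys \<Longrightarrow> evals_to f ys z \<Longrightarrow> evals_to (Comp f gs) xs z"
| Prec_0: "evals_to f xs y \<Longrightarrow> evals_to (Prec f g) (0 # xs) y"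
| Prec_Suc: "evals_to (Prec f g) (n # xs) r \<Longrightarrow> evals_to g (n # r # xs) y \<Longrightarrow>
    evals_to (Prec f g) (Suc n # xs) y"
| Mu: "evals_to f (n # xs) 0 \<Longrightarrow> (\<And>i. i < n \<Longrightarrow> \<exists>y. evals_to f (i # xs) (Suc y)) \<Longrightarrow>
    evals_to (Mu f) xs n"

lemma evals_to_deterministic: "evals_to f xs y \<Longrightarrow> evals_to f xs y' \<Longrightarrow> y = y'"
proof (induction arbitrary: y' rule: evals_to.induct)
  case (Zero xs)
  then show ?case by (auto elim: evals_to.cases)
next
  case (Succ x)
  then show ?case by (auto elim: evals_to.cases)
next
  case (Proj i xs)
  from Proj.prems show ?case by (cases rule: evals_to.cases) auto
next
  case (Comp xs gs ys f z)
  from Comp.prems obtain ys' where ys': "list_all2 (\<lambda>g y. evals_to g xs y) gs ys'" "evals_to f ys' y'"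
    by (cases rule: evals_to.cases) auto
  have "ys = ys'"
    using Comp.IH(1) ys'(1) by (auto simp: list_all2_conv_all_nth intro!: nth_equalityI)
  then show ?case using Comp.IH(2) ys'(2) by simp
next
  case (Prec_0 f xs y g)
  from Prec_0.prems show ?case by (cases rule: evals_to.cases) (auto dest: Prec_0.IH)
next
  case (Prec_Suc f g n xs r y)
  from Prec_Suc.prems obtain r' where "evals_to (Prec f g) (n # xs) r'" "evals_to g (n # r' # xs) y'"
    by (cases rule: evals_to.cases) auto
  then show ?case using Prec_Suc.IH by metis
next
  case (Mu f n xs)
  from Mu.prems obtain y0: "evals_to f (y' # xs) 0"
    and below: "\<And>i. i < y' \<Longrightarrow> \<exists>y. evals_to f (i # xs) (Suc y)"
    by (cases rule: evals_to.cases) auto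
  show ?case
  proof (cases n y' rule: linorder_cases)
    case less
    then show ?thesis using below Mu.IH(1) by fastforce
  next
    case greater
    then show ?thesis using y0 Mu.IH(2) by fastforce
  qed
qed

text \<open>
  A decision problem consists of a set of instances, a coding of the instances by natural numbers
  and the set of positive instances. The algorithm only has to halt on codes of instances; no
  requirement is made on other numbers.
\<close>

definition decidable :: "('i \<Rightarrow> nat) \<Rightarrow> 'i set \<Rightarrow> ('i \<Rightarrow> bool) \<Rightarrow> bool" where
  "decidable code I P \<longleftrightarrow> (\<exists>f. \<forall>x\<in>I. evals_to f [code x] (if P x then 1 else 0))"

section \<open>Markov decision processes\<close>

record 'c mdp =
  confs :: "'c set"
  player_confs :: "'c set"
  prob_confs :: "'c set"
  step :: "'c \<Rightarrow> 'c \<Rightarrow> bool"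
  trans_prob :: "'c \<Rightarrow> 'c \<Rightarrow> real"

definition deadlock :: "'c mdp \<Rightarrow> 'c \<Rightarrow> bool" where
  "deadlock M c \<longleftrightarrow> (\<forall>c'. \<not> step M c c')"

definition finite_play :: "'c mdp \<Rightarrow> 'c list \<Rightarrow> bool" where
  "finite_play M h \<longleftrightarrow> h \<noteq> [] \<and> set h \<subseteq> confs M \<and> successively (step M) h"

definition strategies :: "'c mdp \<Rightarrow> ('c list \<Rightarrow> 'c) set" where
  "strategies M = {\<sigma>. \<forall>h. finite_play M h \<and> last h \<in> player_confs M \<and> \<not> deadlock M (last h)
     \<longrightarrow> step M (last h) (\<sigma> h)}"

text \<open>
  A maximal play is a sequence \<open>\<omega> :: nat \<Rightarrow> 'c option\<close>: an infinite play never takes the value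
  \<^const>\<open>None\<close>, and a finite play ending in a deadlock is followed by \<^const>\<open>None\<close> forever.
\<close>

definition maximal_play :: "'c mdp \<Rightarrow> (nat \<Rightarrow> 'c option) \<Rightarrow> bool" where
  "maximal_play M \<omega> \<longleftrightarrow> (\<exists>c\<in>confs M. \<omega> 0 = Some c) \<and>
     (\<forall>i. case \<omega> i of
        None \<Rightarrow> \<omega> (Suc i) = None
      | Some c \<Rightarrow> if deadlock M c then \<omega> (Suc i) = None
                  else (\<exists>c'. \<omega> (Suc i) = Some c' \<and> step M c c'))"

definition history :: "(nat \<Rightarrow> 'c option) \<Rightarrow> nat \<Rightarrow> 'c list" where
  "history \<omega> i = map (\<lambda>j. the (\<omega> j)) [0..<Suc i]"

definition outcome :: "'c mdp \<Rightarrow> 'c \<Rightarrow> ('c list \<Rightarrow> 'c) \<Rightarrow> (nat \<Rightarrow> 'c option) set" where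
  "outcome M c \<sigma> = {\<omega>. maximal_play M \<omega> \<and> \<omega> 0 = Some c \<and>
     (\<forall>i d d'. \<omega> i = Some d \<and> d \<in> player_confs M \<and> \<omega> (Suc i) = Some d' \<longrightarrow> d' = \<sigma> (history \<omega> i))}"

text \<open>
  The distribution of the \<open>n\<close>-th entry of a play given the earlier ones; it is extended to a
  measure on all sequences by the Ionescu-Tulcea theorem.
\<close>

primrec next_pmf :: "'c mdp \<Rightarrow> 'c \<Rightarrow> ('c list \<Rightarrow> 'c) \<Rightarrow> nat \<Rightarrow> (nat \<Rightarrow> 'c option) \<Rightarrow> 'c option pmf" where
  "next_pmf M c \<sigma> 0 \<omega> = return_pmf (Some c)"
| "next_pmf M c \<sigma> (Suc i) \<omega> = (case \<omega> i of
     None \<Rightarrow> return_pmf None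
   | Some d \<Rightarrow>
       if deadlock M d then return_pmf None
       else if d \<in> player_confs M then return_pmf (Some (\<sigma> (history \<omega> i)))
       else map_pmf Some (embed_pmf (trans_prob M d)))"

definition play_kernel :: "'c mdp \<Rightarrow> 'c \<Rightarrow> ('c list \<Rightarrow> 'c) \<Rightarrow> nat \<Rightarrow> (nat \<Rightarrow> 'c option) \<Rightarrow> 'c option measure"
  where "play_kernel M c \<sigma> n \<omega> = measure_pmf (next_pmf M c \<sigma> n \<omega>)"

definition play_measure :: "'c mdp \<Rightarrow> 'c \<Rightarrow> ('c list \<Rightarrow> 'c) \<Rightarrow> (nat \<Rightarrow> 'c option) measure" where
  "play_measure M c \<sigma> = projective_family.lim UNIV
     (Ionescu_Tulcea.CI (play_kernel M c \<sigma>) (\<lambda>_. count_space UNIV)) (\<lambda>_. count_space UNIV)"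

lemma Ionescu_Tulcea_play_kernel:
  "Ionescu_Tulcea (play_kernel M c \<sigma>) (\<lambda>_. count_space (UNIV :: 'c :: countable option set))"
proof (rule Ionescu_Tulcea.intro)
  fix i :: nat
  have "Pi\<^sub>M {0..<i} (\<lambda>_. count_space (UNIV :: 'c option set)) = count_space ({0..<i} \<rightarrow>\<^sub>E UNIV)"
    by (rule count_space_PiM_finite) auto
  moreover have "measure_pmf p \<in> space (subprob_algebra (count_space UNIV))" for p :: "'c option pmf"
    by (simp add: space_subprob_algebra measure_pmf.subprob_space_axioms)
  ultimately show "play_kernel M c \<sigma> i
      \<in> measurable (Pi\<^sub>M {0..<i} (\<lambda>_. count_space UNIV)) (subprob_algebra (count_space UNIV))"
    by (simp add: play_kernel_def)
qed (unfold play_kernel_def, rule measure_pmf.prob_space_axioms)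

lemma sets_play_measure [measurable_cong]:
  fixes M :: "'c :: countable mdp"
  shows "sets (play_measure M c \<sigma>) = sets (\<Pi>\<^sub>M _\<in>UNIV. count_space UNIV)"
proof -
  interpret Ionescu_Tulcea "play_kernel M c \<sigma>" "\<lambda>_. count_space UNIV"
    by (rule Ionescu_Tulcea_play_kernel)
  show ?thesis by (simp add: play_measure_def)
qed

lemma space_play_measure [simp]:
  fixes M :: "'c :: countable mdp"
  shows "space (play_measure M c \<sigma>) = UNIV"
  using sets_eq_imp_space_eq[OF sets_play_measure[of M c \<sigma>]] by (simp add: space_PiM)

lemma next_pmf_cong:
  assumes "\<And>i. i < n \<Longrightarrow> \<omega> i = \<omega>' i"
  shows "next_pmf M c \<sigma> n \<omega> = next_pmf M c \<sigma> n \<omega>'"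
proof (cases n)
  case (Suc i)
  then have "history \<omega> i = history \<omega>' i"
    using assms by (auto simp: history_def)
  with Suc assms[of i] show ?thesis by (auto split: option.split)
qed simp

lemma prob_space_play_measure:
  fixes M :: "'c :: countable mdp"
  shows "prob_space (play_measure M c \<sigma>)"
proof -
  interpret Ionescu_Tulcea "play_kernel M c \<sigma>" "\<lambda>_. count_space UNIV"
    by (rule Ionescu_Tulcea_play_kernel)
  interpret CI: prob_space "CI {}" by (rule PF.prob_space_P) auto
  have "emeasure PF.lim (PF.emb UNIV {} (space (CI {}))) = 1"
    using CI.emeasure_space_1 by (subst lim) (auto simp: CI_def)
  moreover have "PF.emb UNIV {} (space (CI {})) = space PF.lim"
    by (auto simp: CI_def prod_emb_def space_PiM)
  ultimately show ?thesis by (auto simp: play_measure_def intro!: prob_spaceI)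
qed

lemma measure_play_cylinder_Suc:
  fixes M :: "'c :: countable mdp"
  shows "measure (play_measure M c \<sigma>) {\<omega>. \<forall>i<Suc n. \<omega> i = x i} =
    measure (play_measure M c \<sigma>) {\<omega>. \<forall>i<n. \<omega> i = x i} * pmf (next_pmf M c \<sigma> n x) (x n)"
proof -
  interpret Ionescu_Tulcea "play_kernel M c \<sigma>" "\<lambda>_. count_space UNIV"
    by (rule Ionescu_Tulcea_play_kernel)
  define X where "X m = {restrict x {0..<m}}" for m
  have PiM: "Pi\<^sub>M {0..<m} (\<lambda>_. count_space (UNIV :: 'c option set)) = count_space ({0..<m} \<rightarrow>\<^sub>E UNIV)"
    for m :: nat by (rule count_space_PiM_finite) auto
  have X: "X m \<in> sets (Pi\<^sub>M {0..<m} (\<lambda>_. count_space (UNIV :: 'c option set)))" for m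
    by (auto simp: PiM X_def)
  have emb: "PF.emb UNIV {0..<m} (X m) = {\<omega>. \<forall>i<m. \<omega> i = x i}" for m
    by (auto simp: prod_emb_def X_def fun_eq_iff restrict_def split: if_splits)
  have cyl: "emeasure (play_measure M c \<sigma>) {\<omega>. \<forall>i<m. \<omega> i = x i} = emeasure (C 0 m (\<lambda>_. undefined)) (X m)"
    for m
  proof -
    have "emeasure (play_measure M c \<sigma>) (PF.emb UNIV {0..<m} (X m)) = emeasure (CI {0..<m}) (X m)"
      unfolding play_measure_def by (rule lim) (use X in auto)
    also have "\<dots> = emeasure (C 0 m (\<lambda>_. undefined)) (PF.emb {0..<m} {0..<m} (X m))"
      by (rule emeasure_CI) (use X in auto)
    also have "PF.emb {0..<m} {0..<m} (X m) = X m"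
      using X by (intro prod_emb_id) (auto simp: X_def)
    finally show ?thesis by (simp add: emb)
  qed
  let ?u = "(\<lambda>_. undefined) :: nat \<Rightarrow> 'c option"
  have u: "?u \<in> space (Pi\<^sub>M {0..<0} (\<lambda>_. count_space UNIV))"
    by (simp add: space_PiM)
  have eP: "emeasure (eP n \<omega>) (X (Suc n)) = ennreal (pmf (next_pmf M c \<sigma> n x) (x n)) * indicator (X n) \<omega>"
    if \<omega>: "\<omega> \<in> space (Pi\<^sub>M {0..<n} (\<lambda>_. count_space UNIV))" for \<omega>
  proof -
    have ext: "\<omega> \<in> extensional {0..<n}"
      using \<omega> by (auto simp: space_PiM PiE_def)
    have "emeasure (eP n \<omega>) (X (Suc n)) = play_kernel M c \<sigma> n \<omega> {y. fun_upd \<omega> n y \<in> X (Suc n)}"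
      by (subst emeasure_eP[OF \<omega> X]) (simp add: vimage_def)
    also have "{y. fun_upd \<omega> n y \<in> X (Suc n)} = (if \<omega> \<in> X n then {x n} else {})"
    proof -
      have "fun_upd \<omega> n y \<in> X (Suc n) \<longleftrightarrow> \<omega> \<in> X n \<and> y = x n" for y
      proof
        assume "fun_upd \<omega> n y \<in> X (Suc n)"
        then have eq: "fun_upd \<omega> n y = restrict x {0..<Suc n}" by (simp add: X_def)
        have "y = x n" using fun_cong[OF eq, of n] by simp
        moreover have "\<omega> = restrict x {0..<n}"
        proof
          fix i show "\<omega> i = restrict x {0..<n} i"
            using fun_cong[OF eq, of i] ext by (cases "i < n") (auto simp: extensional_def)
        qed
        ultimately show "\<omega> \<in> X n \<and> y = x n" by (simp add: X_def)
      qed (auto simp: X_def fun_eq_iff restrict_def)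
      then show ?thesis by auto
    qed
    also have "play_kernel M c \<sigma> n \<omega> \<dots> = ennreal (pmf (next_pmf M c \<sigma> n x) (x n)) * indicator (X n) \<omega>"
    proof (cases "\<omega> \<in> X n")
      case True
      then have "next_pmf M c \<sigma> n \<omega> = next_pmf M c \<sigma> n x"
        by (intro next_pmf_cong) (auto simp: X_def)
      with True show ?thesis by (simp add: play_kernel_def emeasure_pmf_single)
    qed simp
    finally show ?thesis .
  qed
  have "emeasure (C 0 (Suc n) ?u) (X (Suc n)) = (\<integral>\<^sup>+\<omega>. emeasure (eP n \<omega>) (X (Suc n)) \<partial>C 0 n ?u)"
  proof -
    have "space (C 0 n ?u) \<noteq> {}"
      using prob_space.not_empty[OF prob_space_C[OF u]] .
    moreover have "eP n \<in> measurable (C 0 n ?u) (subprob_algebra (Pi\<^sub>M {0..<Suc n} (\<lambda>_. count_space UNIV)))"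
      using measurable_eP[of n] sets_C[OF u, of n] by (simp cong: measurable_cong_sets)
    ultimately show ?thesis using X[of "Suc n"] by (simp add: emeasure_bind)
  qed
  also have "\<dots> = (\<integral>\<^sup>+\<omega>. ennreal (pmf (next_pmf M c \<sigma> n x) (x n)) * indicator (X n) \<omega> \<partial>C 0 n ?u)"
    by (rule nn_integral_cong) (use eP space_C[OF u, of n] in simp)
  also have "\<dots> = ennreal (pmf (next_pmf M c \<sigma> n x) (x n)) * emeasure (C 0 n ?u) (X n)"
    using X[of n] sets_C[OF u, of n] by (subst nn_integral_cmult_indicator) simp_all
  finally show ?thesis
    unfolding measure_def cyl by (simp add: enn2real_mult mult.commute)
qed

section \<open>Vector addition systems with states\<close>

type_synonym 'q transition = "'q \<times> int list \<times> 'q"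
type_synonym 'q config = "'q \<times> nat list"

record 'q vass =
  states :: "'q set"
  player_states :: "'q set"
  prob_states :: "'q set"
  transitions :: "'q transition set"
  weight :: "'q transition \<Rightarrow> nat"

text \<open>
  Vectors of dimension \<open>d\<close> are lists of length \<open>d\<close>. The weight function is
  extensional, i.e. a function on the set of transitions only.
\<close>

definition vass_mdp :: "nat \<Rightarrow> 'q vass \<Rightarrow> bool" where
  "vass_mdp d S \<longleftrightarrow>
     finite (states S) \<and>
     player_states S \<union> prob_states S = states S \<and> player_states S \<inter> prob_states S = {} \<and>
     finite (transitions S) \<and> transitions S \<subseteq> states S \<times> {z. length z = d} \<times> states S \<and>
     weight S \<in> transitions S \<rightarrow>\<^sub>E {0<..}"

definition p_vass_mdp :: "nat \<Rightarrow> 'q vass \<Rightarrow> bool" where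
  "p_vass_mdp d S \<longleftrightarrow> vass_mdp d S \<and>
     (\<forall>(q, z, q') \<in> transitions S. q \<in> player_states S \<longrightarrow> z = replicate d 0)"

fun enabled :: "'q transition \<Rightarrow> 'q config \<Rightarrow> bool" where
  "enabled (p, z, p') (q, v) \<longleftrightarrow> p = q \<and> list_all2 (\<lambda>n k. 0 \<le> int n + k) v z"

fun fire :: "'q transition \<Rightarrow> 'q config \<Rightarrow> 'q config" where
  "fire (p, z, p') (q, v) = (p', map2 (\<lambda>n k. nat (int n + k)) v z)"

definition enabled_transitions :: "'q vass \<Rightarrow> 'q config \<Rightarrow> 'q transition set" where
  "enabled_transitions S c = {t \<in> transitions S. enabled t c}"

definition induced_mdp :: "nat \<Rightarrow> 'q vass \<Rightarrow> 'q config mdp" where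
  "induced_mdp d S = \<lparr>
     confs = states S \<times> {v. length v = d},
     player_confs = player_states S \<times> {v. length v = d},
     prob_confs = prob_states S \<times> {v. length v = d},
     step = (\<lambda>c c'. c \<in> states S \<times> {v. length v = d} \<and> (\<exists>t\<in>enabled_transitions S c. c' = fire t c)),
     trans_prob = (\<lambda>c c'. (\<Sum>t | t \<in> enabled_transitions S c \<and> fire t c = c'. real (weight S t)) /
                    (\<Sum>t\<in>enabled_transitions S c. real (weight S t)))\<rparr>"

lemma pmf_embed_pmf_induced_mdp:
  assumes S: "vass_mdp d S" and c: "\<not> deadlock (induced_mdp d S) c"
  shows "pmf (embed_pmf (trans_prob (induced_mdp d S) c)) c' = trans_prob (induced_mdp d S) c c'"
proof (rule pmf_embed_pmf)
  let ?E = "enabled_transitions S c" and ?w = "\<lambda>t. real (weight S t)"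
  have fin: "finite ?E" and pos: "\<And>t. t \<in> ?E \<Longrightarrow> 0 < ?w t"
    using S by (auto simp: vass_mdp_def enabled_transitions_def dest!: PiE_mem)
  have ne: "?E \<noteq> {}"
    using c by (auto simp: deadlock_def induced_mdp_def)
  let ?p = "trans_prob (induced_mdp d S) c"
  show nonneg: "0 \<le> ?p x" for x
    by (simp add: induced_mdp_def sum_nonneg)
  have zero: "?p x = 0" if "x \<notin> (\<lambda>t. fire t c) ` ?E" for x
    using that by (auto simp: induced_mdp_def intro!: sum.neutral)
  have "(\<integral>\<^sup>+x. ennreal (?p x) \<partial>count_space UNIV) = (\<Sum>x\<in>(\<lambda>t. fire t c) ` ?E. ennreal (?p x))"
    by (rule nn_integral_count_space'[OF _ _ subset_UNIV]) (use fin zero in auto)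
  also have "\<dots> = ennreal (\<Sum>x\<in>(\<lambda>t. fire t c) ` ?E. ?p x)"
    by (simp add: nonneg sum_ennreal)
  also have "(\<Sum>x\<in>(\<lambda>t. fire t c) ` ?E. ?p x) =
      (\<Sum>x\<in>(\<lambda>t. fire t c) ` ?E. sum ?w {t\<in>?E. fire t c = x}) / sum ?w ?E"
    by (simp add: induced_mdp_def sum_divide_distrib)
  also have "(\<Sum>x\<in>(\<lambda>t. fire t c) ` ?E. sum ?w {t\<in>?E. fire t c = x}) = sum ?w ?E"
    by (rule sum.image_gen[OF fin, symmetric])
  also have "\<dots> / \<dots> = 1"
    using sum_pos[of ?E ?w, OF fin ne pos] by simp
  finally show "(\<integral>\<^sup>+x. ennreal (?p x) \<partial>count_space UNIV) = 1" by simp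
qed

section \<open>Objectives and decision problems\<close>

text \<open>
  The objectives are sets of arbitrary sequences; both \<^const>\<open>outcome\<close> and
  \<^const>\<open>play_measure\<close> only see the maximal plays among them.
\<close>

definition reach :: "'q \<Rightarrow> (nat \<Rightarrow> 'q config option) set" where
  "reach q = {\<omega>. \<exists>i v. \<omega> i = Some (q, v)}"

definition repeated_reach :: "'q \<Rightarrow> (nat \<Rightarrow> 'q config option) set" where
  "repeated_reach q = {\<omega>. (\<forall>i. \<omega> i \<noteq> None) \<and> (\<forall>n. \<exists>i\<ge>n. \<exists>v. \<omega> i = Some (q, v))}"

lemma sets_reach:
  "reach q \<in> sets (play_measure (M :: ('q :: countable) config mdp) c \<sigma>)"
proof -
  have "reach q = (\<Union>i. \<Union>v. {\<omega> \<in> space (play_measure M c \<sigma>). \<omega> i = Some (q, v)})"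
    by (auto simp: reach_def)
  also have "\<dots> \<in> sets (play_measure M c \<sigma>)" by measurable
  finally show ?thesis .
qed

lemma sets_repeated_reach:
  "repeated_reach q \<in> sets (play_measure (M :: ('q :: countable) config mdp) c \<sigma>)"
proof -
  have "repeated_reach q = {\<omega> \<in> space (play_measure M c \<sigma>). (\<forall>i. \<omega> i \<noteq> None) \<and> (\<forall>n. \<exists>i\<in>{n..}. \<exists>v. \<omega> i = Some (q, v))}"
    by (simp add: repeated_reach_def Bex_def)
  also have "\<dots> \<in> sets (play_measure M c \<sigma>)" by measurable
  finally show ?thesis .
qed

definition sure :: "'c mdp \<Rightarrow> 'c \<Rightarrow> (nat \<Rightarrow> 'c option) set \<Rightarrow> bool" where
  "sure M c X \<longleftrightarrow> (\<exists>\<sigma>\<in>strategies M. outcome M c \<sigma> \<subseteq> X)"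

definition almost_sure :: "'c mdp \<Rightarrow> 'c \<Rightarrow> (nat \<Rightarrow> 'c option) set \<Rightarrow> bool" where
  "almost_sure M c X \<longleftrightarrow> (\<exists>\<sigma>\<in>strategies M. measure (play_measure M c \<sigma>) X = 1)"

definition limit_sure :: "'c mdp \<Rightarrow> 'c \<Rightarrow> (nat \<Rightarrow> 'c option) set \<Rightarrow> bool" where
  "limit_sure M c X \<longleftrightarrow> (SUP \<sigma>\<in>strategies M. measure (play_measure M c \<sigma>) X) = 1"

text \<open>
  In the decision problems the control states are natural numbers, which up to renaming covers
  every finite set of control states.
\<close>

type_synonym vass_instance = "nat vass \<times> nat config \<times> nat"

definition p_vass_instances :: "nat \<Rightarrow> vass_instance set" where
  "p_vass_instances d =
     {(S, c\<^sub>0, q\<^sub>F). p_vass_mdp d S \<and> c\<^sub>0 \<in> confs (induced_mdp d S) \<and> q\<^sub>F \<in> states S}"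

fun transition_code :: "nat transition \<Rightarrow> nat \<Rightarrow> nat" where
  "transition_code (p, z, p') w = list_encode [p, list_encode (map int_encode z), p', w]"

definition vass_code :: "nat vass \<Rightarrow> nat" where
  "vass_code S = list_encode
     [set_encode (states S), set_encode (player_states S), set_encode (prob_states S),
      set_encode ((\<lambda>t. transition_code t (weight S t)) ` transitions S)]"

fun instance_code :: "vass_instance \<Rightarrow> nat" where
  "instance_code (S, (q, v), q\<^sub>F) = list_encode [vass_code S, q, list_encode v, q\<^sub>F]"

lemma transition_code_eq [simp]:
  "transition_code t w = transition_code t' w' \<longleftrightarrow> t = t' \<and> w = w'"
  by (cases t; cases t') (auto simp: list_encode_eq inj_map_eq_map[OF inj_int_encode])

lemma inj_on_vass_code: "inj_on vass_code {S. vass_mdp d S}"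
proof (rule inj_onI)
  fix S S' assume S: "S \<in> {S. vass_mdp d S}" and S': "S' \<in> {S. vass_mdp d S}"
    and eq: "vass_code S = vass_code S'"
  have fin: "finite (states S)" "finite (player_states S)" "finite (prob_states S)" "finite (transitions S)"
    "finite (states S')" "finite (player_states S')" "finite (prob_states S')" "finite (transitions S')"
    using S S' by (auto simp: vass_mdp_def) (metis finite_Un)+
  then have *: "states S = states S'" "player_states S = player_states S'" "prob_states S = prob_states S'"
    and im: "(\<lambda>t. transition_code t (weight S t)) ` transitions S =
      (\<lambda>t. transition_code t (weight S' t)) ` transitions S'"
    using eq by (simp_all add: vass_code_def list_encode_eq set_encode_eq)
  have T: "t \<in> transitions S' \<and> weight S t = weight S' t" if "t \<in> transitions S" for t
    using imageI[OF that, of "\<lambda>t. transition_code t (weight S t)"] unfolding im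
    by (auto simp del: transition_code.simps)
  have T': "t \<in> transitions S" if "t \<in> transitions S'" for t
    using imageI[OF that, of "\<lambda>t. transition_code t (weight S' t)"] unfolding im[symmetric]
    by (auto simp del: transition_code.simps)
  have trans: "transitions S = transitions S'" using T T' by blast
  have "weight S = weight S'"
    by (rule extensionalityI[of _ "transitions S"]) (use S S' T trans in \<open>auto simp: vass_mdp_def PiE_def\<close>)
  with * trans show "S = S'" by (intro vass.equality) auto
qed

lemma inj_on_instance_code: "inj_on instance_code (p_vass_instances d)"
proof (rule inj_onI)
  fix x y assume "x \<in> p_vass_instances d" "y \<in> p_vass_instances d" "instance_code x = instance_code y"
  then show "x = y"
    by (cases x; cases y)
       (auto simp: p_vass_instances_def p_vass_mdp_def list_encode_eq dest: inj_onD[OF inj_on_vass_code])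
qed

fun sure_reachability :: "nat \<Rightarrow> vass_instance \<Rightarrow> bool" where
  "sure_reachability d (S, c\<^sub>0, q\<^sub>F) = sure (induced_mdp d S) c\<^sub>0 (reach q\<^sub>F)"

fun almost_sure_reachability :: "nat \<Rightarrow> vass_instance \<Rightarrow> bool" where
  "almost_sure_reachability d (S, c\<^sub>0, q\<^sub>F) = almost_sure (induced_mdp d S) c\<^sub>0 (reach q\<^sub>F)"

fun limit_sure_reachability :: "nat \<Rightarrow> vass_instance \<Rightarrow> bool" where
  "limit_sure_reachability d (S, c\<^sub>0, q\<^sub>F) = limit_sure (induced_mdp d S) c\<^sub>0 (reach q\<^sub>F)"

fun sure_repeated_reachability :: "nat \<Rightarrow> vass_instance \<Rightarrow> bool" where
  "sure_repeated_reachability d (S, c\<^sub>0, q\<^sub>F) = sure (induced_mdp d S) c\<^sub>0 (repeated_reach q\<^sub>F)"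

fun almost_sure_repeated_reachability :: "nat \<Rightarrow> vass_instance \<Rightarrow> bool" where
  "almost_sure_repeated_reachability d (S, c\<^sub>0, q\<^sub>F) =
     almost_sure (induced_mdp d S) c\<^sub>0 (repeated_reach q\<^sub>F)"

fun limit_sure_repeated_reachability :: "nat \<Rightarrow> vass_instance \<Rightarrow> bool" where
  "limit_sure_repeated_reachability d (S, c\<^sub>0, q\<^sub>F) =
     limit_sure (induced_mdp d S) c\<^sub>0 (repeated_reach q\<^sub>F)"

end

theory Submission
  imports Defs
begin

text \<open>
  A two-counter machine is turned into a P-VASS-MDP in which Player 1 only announces the outcome of
  each zero test. Announcing ``nonzero'' leads to a probabilistic state whose single transition
  decrements, hence to a deadlock if the counter is zero. Announcing ``zero'' leads to a
  probabilistic state that offers the continuation and a decrement into a losing sink; the latter is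
  enabled exactly if the announcement was wrong. If the machine reaches its accepting label, the
  honest strategy admits a single play, which is winning. Otherwise every strategy admits a
  losing play of probability at least 1/2, namely the one that enters the sink as soon as this is
  enabled. So one construction serves all six problems.

  If \<open>f\<close> decided one of them, let \<open>p\<close> be a machine that, started with \<open>2\<^sup>x\<close> in the
  first counter, computes the code of the instance consisting of the VASS with code \<open>x\<close>, fixed
  control states and the initial counters \<open>2\<^sup>x\<close> and \<open>0\<close>, runs \<open>f\<close> on it and accepts iff
  the answer is 0. Taking for \<open>x\<close> the code of the VASS of \<open>p\<close> itself gives a contradiction.
  Since \<open>f\<close> halts on all instances, \<open>p\<close> reaches an accepting or a stuck configuration,
  so that only terminating computations have to be simulated.
\<close>

section \<open>Loop programs\<close>

text \<open>\<open>Loop r b\<close> tests and decrements \<open>r\<close> before every pass; as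
  \<open>b\<close> may write to \<open>r\<close>, the loop is unbounded. \<open>Stop\<close> has no
  rule in \<open>op_step\<close>: getting stuck there serves as rejection.\<close>

datatype op = Inc nat | Loop nat "op list" | Stop

inductive op_step :: "op list \<times> (nat \<Rightarrow> nat) \<Rightarrow> op list \<times> (nat \<Rightarrow> nat) \<Rightarrow> bool" where
  Inc: "op_step (Inc r # k, s) (k, s(r := Suc (s r)))"
| Loop_0: "s r = 0 \<Longrightarrow> op_step (Loop r b # k, s) (k, s)"
| Loop_Suc: "s r = Suc n \<Longrightarrow> op_step (Loop r b # k, s) (b @ Loop r b # k, s(r := n))"

text \<open>The continuation \<open>k\<close> is arbitrary so that runs of fragments compose, in
  particular those of a loop body, which is pushed in front of the loop itself.\<close>

definition exec :: "op list \<Rightarrow> (nat \<Rightarrow> nat) \<Rightarrow> (nat \<Rightarrow> nat) \<Rightarrow> bool" where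
  "exec a s t \<longleftrightarrow> (\<forall>k. op_step\<^sup>*\<^sup>* (a @ k, s) (k, t))"

lemma exec_Nil: "exec [] s s"
  by (simp add: exec_def)

lemma exec_append: "exec a s t \<Longrightarrow> exec b t u \<Longrightarrow> exec (a @ b) s u"
  unfolding exec_def by (metis append.assoc rtranclp_trans)

lemma exec_Cons: "exec [x] s t \<Longrightarrow> exec b t u \<Longrightarrow> exec (x # b) s u"
  using exec_append[of "[x]"] by simp

lemma exec_Inc: "exec [Inc r] s (s(r := Suc (s r)))"
  unfolding exec_def using op_step.Inc by auto

lemma exec_Loop_0: "s r = 0 \<Longrightarrow> exec [Loop r b] s s"
  unfolding exec_def using op_step.Loop_0 by auto

lemma exec_Loop_Suc:
  assumes "s r = Suc n" "exec b (s(r := n)) t" "exec [Loop r b] t u"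
  shows "exec [Loop r b] s u"
  unfolding exec_def
proof
  fix k
  have "op_step ([Loop r b] @ k, s) (b @ [Loop r b] @ k, s(r := n))"
    using op_step.Loop_Suc[where s = s, OF assms(1)] by simp
  also have "op_step\<^sup>*\<^sup>* \<dots> ([Loop r b] @ k, t)"
    using assms(2) unfolding exec_def by blast
  also have "op_step\<^sup>*\<^sup>* \<dots> (k, u)"
    using assms(3) unfolding exec_def by blast
  finally show "op_step\<^sup>*\<^sup>* ([Loop r b] @ k, s) (k, u)" .
qed

text \<open>\<open>s i\<close> is the state at the loop head after \<open>i\<close> passes; the
  induction is on the passes that remain. It serves for loops with a known number of passes.\<close>

lemma exec_Loop_iterate:
  assumes "\<And>i. i < n \<Longrightarrow> s i r = n - i"
    and "\<And>i. i < n \<Longrightarrow> exec b ((s i)(r := n - Suc i)) (s (Suc i))"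
    and "s n r = 0"
  shows "exec [Loop r b] (s 0) (s n)"
proof -
  have "i \<le> n \<Longrightarrow> exec [Loop r b] (s i) (s n)" for i
  proof (induction "n - i" arbitrary: i)
    case 0
    then show ?case using exec_Loop_0 assms(3) by simp
  next
    case (Suc m)
    then have "i < n" "s i r = Suc (n - Suc i)" using assms(1) by (simp_all add: Suc_diff_Suc)
    then show ?case
      using Suc exec_Loop_Suc assms(2) by (metis Suc_diff_Suc Suc_inject Suc_leI)
  qed
  then show ?thesis by simp
qed

lemma exec_clear: "exec [Loop r []] s (s(r := 0))"
  using exec_Loop_iterate[of "s r" "\<lambda>i. s(r := s r - i)" r "[]"] exec_Nil by simp

lemma exec_move:
  assumes "q \<noteq> r"
  shows "exec [Loop q [Inc r]] s (s(q := 0, r := s r + s q))"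
proof -
  have "exec [Inc r] ((s(q := s q - i, r := s r + i))(q := s q - Suc i)) (s(q := s q - Suc i, r := s r + Suc i))" for i
    using exec_Inc[of r "(s(q := s q - i, r := s r + i))(q := s q - Suc i)"] assms
    by (simp add: fun_upd_twist)
  then show ?thesis
    using exec_Loop_iterate[of "s q" "\<lambda>i. s(q := s q - i, r := s r + i)" q "[Inc r]"] assms by simp
qed

text \<open>Reading a register empties it. So the first loop fills both \<open>r\<close> and the
  scratch register \<open>t\<close>, and the second restores \<open>q\<close> from
  \<open>t\<close>.\<close>

definition copy :: "nat \<Rightarrow> nat \<Rightarrow> nat \<Rightarrow> op list" where
  "copy q r t = [Loop q [Inc r, Inc t], Loop t [Inc q]]"

lemma exec_copy:
  assumes "q \<noteq> r" "t \<noteq> q" "t \<noteq> r" "s r = 0" "s t = 0"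
  shows "exec (copy q r t) s (s(r := s q))"
proof -
  let ?s = "\<lambda>i. s(q := s q - i, r := i, t := i)"
  have "exec [Inc r, Inc t] ((?s i)(q := s q - Suc i)) (?s (Suc i))" for i
  proof -
    let ?u = "(?s i)(q := s q - Suc i)"
    have "exec [Inc r, Inc t] ?u (?u(r := Suc (?u r), t := Suc ((?u(r := Suc (?u r))) t)))"
      by (rule exec_Cons[OF exec_Inc exec_Inc])
    also have "?u(r := Suc (?u r), t := Suc ((?u(r := Suc (?u r))) t)) = ?s (Suc i)"
      using assms by (auto simp: fun_eq_iff)
    finally show ?thesis .
  qed
  then have *: "exec [Loop q [Inc r, Inc t]] (?s 0) (?s (s q))"
    using assms by (intro exec_Loop_iterate[where s = ?s]) (simp_all del: fun_upd_apply, simp_all add: fun_upd_same)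
  moreover have "?s 0 = s" using assms by (auto simp: fun_eq_iff)
  moreover have "exec [Loop t [Inc q]] (?s (s q)) (s(r := s q))"
  proof -
    have "(?s (s q))(t := 0, q := ?s (s q) q + ?s (s q) t) = s(r := s q)"
      using assms by (auto simp: fun_eq_iff)
    then show ?thesis using exec_move[of t q "?s (s q)"] assms by simp
  qed
  ultimately show ?thesis
    unfolding copy_def by (metis exec_Cons)
qed

section \<open>Compilation of recursive terms to loop programs\<close>

text \<open>
  \<open>compile f args out t\<close> reads the arguments from the registers \<open>args\<close>, writes the value
  to \<open>out\<close> and uses the registers from \<open>t\<close> on as scratch space, which is zero before and
  after. For \<^const>\<open>Mu\<close> the candidate argument is kept in \<open>out\<close> itself.
\<close>

primrec compile :: "recf \<Rightarrow> nat list \<Rightarrow> nat \<Rightarrow> nat \<Rightarrow> op list" where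
  "compile Zero args out t = []"
| "compile Succ args out t = copy (args ! 0) out t @ [Inc out]"
| "compile (Proj i) args out t = copy (args ! i) out t"
| "compile (Comp f gs) args out t =
     concat (map2 (\<lambda>c j. c args j (t + length gs)) (map compile gs) [t..<t + length gs]) @
     compile f [t..<t + length gs] out (t + length gs) @
     map (\<lambda>j. Loop j []) [t..<t + length gs]"
| "compile (Prec f g) args out t =
     copy (args ! 0) t (t + 1) @
     compile f (tl args) (t + 2) (t + 4) @
     Loop t (compile g ((t + 1) # (t + 2) # tl args) (t + 3) (t + 4) @
       [Loop (t + 2) [], Loop (t + 3) [Inc (t + 2)], Inc (t + 1)]) #
     [Loop (t + 2) [Inc out], Loop (t + 1) []]"
| "compile (Mu f) args out t =
     compile f (out # args) t (t + 1) @
     [Loop t (Loop t [] # Inc out # compile f (out # args) t (t + 1))]"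

text \<open>Provides all intermediate values of the recursion at once, to describe every pass of the
  loop compiled for \<open>Prec\<close>.\<close>

lemma evals_to_Prec:
  assumes "evals_to (Prec f g) (n # xs) y"
  shows "\<exists>v. evals_to f xs (v 0) \<and> (\<forall>k<n. evals_to g (k # v k # xs) (v (Suc k))) \<and> v n = y"
  using assms
proof (induction n arbitrary: y)
  case 0
  then have "evals_to f xs y" by (cases rule: evals_to.cases) auto
  then show ?case by (intro exI[of _ "\<lambda>_. y"]) auto
next
  case (Suc n)
  from Suc.prems obtain r where "evals_to (Prec f g) (n # xs) r" and g: "evals_to g (n # r # xs) y"
    by (cases rule: evals_to.cases) auto
  with Suc.IH obtain v where v: "evals_to f xs (v 0)" "\<forall>k<n. evals_to g (k # v k # xs) (v (Suc k))" "v n = r"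
    by blast
  with g show ?case
    by (intro exI[of _ "v(Suc n := y)"]) (auto simp: less_Suc_eq)
qed

lemma exec_clear_list: "exec (map (\<lambda>j. Loop j []) js) s (\<lambda>i. if i \<in> set js then 0 else s i)"
proof (induction js arbitrary: s)
  case Nil
  then show ?case by (simp add: exec_Nil)
next
  case (Cons j js)
  have "(\<lambda>i. if i \<in> set js then 0 else (s(j := 0)) i) = (\<lambda>i. if i \<in> set (j # js) then 0 else s i)"
    by auto
  then show ?case using exec_Cons[OF exec_clear Cons.IH[of "s(j := 0)"]] by simp
qed

definition overwrite :: "(nat \<Rightarrow> nat) \<Rightarrow> nat \<Rightarrow> nat list \<Rightarrow> nat \<Rightarrow> nat" where
  "overwrite s t ys i = (if t \<le> i \<and> i < t + length ys then ys ! (i - t) else s i)"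

text \<open>Structural induction. Only \<open>out\<close> changes, so the scratch registers are zero
  again after each call and the hypotheses hold for the next one; a nested call has its scratch area
  above the registers still in use.\<close>

theorem exec_compile:
  assumes "evals_to f (map s args) y" "\<forall>r\<in>set args. r < t" "out < t" "out \<notin> set args"
    "s out = 0" "\<forall>r\<ge>t. s r = 0"
  shows "exec (compile f args out t) s (s(out := y))"
  using assms
proof (induction f arbitrary: s args out t y)
  case Zero
  from Zero(1) have "y = 0" by (cases rule: evals_to.cases) auto
  then show ?case using Zero exec_Nil by (simp add: fun_upd_idem)
next
  case Succ
  from Succ(1) obtain x where x: "map s args = [x]" "y = Suc x" by (cases rule: evals_to.cases) auto
  then obtain q where q: "args = [q]" "s q = x" by (cases args) auto
  have "exec (copy q out t) s (s(out := x))"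
    using exec_copy[of q out t s] q Succ by auto
  then show ?case
    using exec_append[OF _ exec_Inc[of out "s(out := x)"]] q x by (simp del: fun_upd_apply) (simp add: fun_upd_same)
next
  case (Proj i)
  from Proj(1) have i: "i < length args" "y = s (args ! i)" by (cases rule: evals_to.cases; auto)+
  then have "args ! i \<in> set args" by simp
  then have "args ! i < t" "out \<noteq> args ! i" using Proj by auto
  with Proj have "exec (copy (args ! i) out t) s (s(out := s (args ! i)))"
    by (intro exec_copy) auto
  then show ?case by (simp only: compile.simps i)
next
  case (Comp f gs)
  from Comp(3) obtain ys where ys: "list_all2 (\<lambda>g y. evals_to g (map s args) y) gs ys" "evals_to f ys y"
    by (cases rule: evals_to.cases) auto
  define u where "u = t + length gs"
  have len: "length ys = length gs" using ys(1) by (simp add: list_all2_lengthD)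
  have args: "exec (concat (map2 (\<lambda>c j. c args j u) (map compile (take m gs)) [t..<t + m])) s (overwrite s t (take m ys))"
    if "m \<le> length gs" for m
    using that
  proof (induction m)
    case 0
    have "overwrite s t [] = s" by (auto simp: overwrite_def)
    then show ?case using exec_Nil by simp
  next
    case (Suc m)
    let ?s = "overwrite s t (take m ys)"
    have m: "m < length gs" using Suc by simp
    have eq: "map ?s args = map s args" using Comp.prems by (auto simp: overwrite_def)
    have "exec (compile (gs ! m) args (t + m) u) ?s (?s(t + m := ys ! m))"
    proof (rule Comp.IH(2))
      show "gs ! m \<in> set gs" using m by simp
      show "evals_to (gs ! m) (map ?s args) (ys ! m)"
        unfolding eq using ys(1) m by (simp add: list_all2_conv_all_nth)
      show "\<forall>r\<in>set args. r < u" using Comp.prems u_def by auto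
      show "t + m < u" using m u_def by simp
      show "t + m \<notin> set args" using Comp.prems by auto
      show "?s (t + m) = 0" "\<forall>r\<ge>u. ?s r = 0" using Comp.prems u_def len m by (auto simp: overwrite_def)
    qed
    moreover have "?s(t + m := ys ! m) = overwrite s t (take (Suc m) ys)"
      using m len by (auto simp: overwrite_def fun_eq_iff nth_take less_Suc_eq take_Suc_conv_app_nth nth_append)
    moreover have "concat (map2 (\<lambda>c j. c args j u) (map compile (take (Suc m) gs)) [t..<t + Suc m]) =
      concat (map2 (\<lambda>c j. c args j u) (map compile (take m gs)) [t..<t + m]) @ compile (gs ! m) args (t + m) u"
      using m by (simp add: take_Suc_conv_app_nth)
    ultimately show ?case using Suc exec_append by simp
  qed
  let ?s = "overwrite s t ys"
  have "exec (concat (map2 (\<lambda>c j. c args j u) (map compile gs) [t..<u])) s ?s"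
    using args[of "length gs"] len by (simp add: u_def)
  moreover have "exec (compile f [t..<u] out u) ?s (?s(out := y))"
  proof (rule Comp.IH(1))
    have "map ?s [t..<u] = ys"
      using len by (intro nth_equalityI) (auto simp: overwrite_def u_def)
    then show "evals_to f (map ?s [t..<u]) y" using ys(2) by simp
  qed (use Comp.prems u_def len in \<open>auto simp: overwrite_def\<close>)
  moreover have "(\<lambda>i. if i \<in> set [t..<u] then 0 else (?s(out := y)) i) = s(out := y)"
    using Comp.prems u_def len by (auto simp: overwrite_def fun_eq_iff)
  then have "exec (map (\<lambda>j. Loop j []) [t..<u]) (?s(out := y)) (s(out := y))"
    using exec_clear_list[of "[t..<u]" "?s(out := y)"] by simp
  ultimately show ?case unfolding compile.simps u_def[symmetric]
    by (intro exec_append)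
next
  case (Prec f g)
  obtain q qs where q: "args = q # qs"
    using Prec.prems(1) by (cases rule: evals_to.cases) auto
  let ?xs = "map s qs"
  define n where "n = s q"
  from Prec.prems(1) have "evals_to (Prec f g) (n # ?xs) y" by (simp add: q n_def)
  then obtain v where v: "evals_to f ?xs (v 0)" "\<And>k. k < n \<Longrightarrow> evals_to g (k # v k # ?xs) (v (Suc k))" "v n = y"
    using evals_to_Prec by blast
  \<comment> \<open>State before pass \<open>i\<close>: register \<open>t\<close> holds the passes
    left, \<open>t + 1\<close> the recursion index and \<open>t + 2\<close> the current value.
    Register \<open>t + 3\<close> receives the next value during the pass.\<close>
  let ?s = "\<lambda>i. s(t := n - i, t + 1 := i, t + 2 := v i)"
  have qs: "\<forall>r\<in>set qs. r < t" "q < t" and z: "\<And>r. r \<ge> t \<Longrightarrow> s r = 0"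
    using Prec.prems q by auto
  have 1: "exec (copy q t (t + 1)) s (s(t := n))"
    using exec_copy[of q t "t + 1" s] qs z by (auto simp: n_def)
  have 2: "exec (compile f qs (t + 2) (t + 4)) (s(t := n)) (?s 0)"
  proof -
    have "exec (compile f qs (t + 2) (t + 4)) (s(t := n)) (s(t := n, t + 2 := v 0))"
    proof (rule Prec.IH(1))
      have "map (s(t := n)) qs = ?xs" using qs by auto
      then show "evals_to f (map (s(t := n)) qs) (v 0)" using v(1) by (simp only:)
    qed (use qs z in auto)
    moreover have "s(t := n, t + 2 := v 0) = ?s 0" using z by (auto simp: fun_eq_iff)
    ultimately show ?thesis by simp
  qed
  let ?b = "compile g ((t + 1) # (t + 2) # qs) (t + 3) (t + 4) @
       [Loop (t + 2) [], Loop (t + 3) [Inc (t + 2)], Inc (t + 1)]"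
  have body: "exec ?b ((?s i)(t := n - Suc i)) (?s (Suc i))" if "i < n" for i
  proof -
    let ?u = "(?s i)(t := n - Suc i)"
    have "exec (compile g ((t + 1) # (t + 2) # qs) (t + 3) (t + 4)) ?u (?u(t + 3 := v (Suc i)))"
    proof (rule Prec.IH(2))
      have "map ?u ((t + 1) # (t + 2) # qs) = i # v i # ?xs" using qs by auto
      then show "evals_to g (map ?u ((t + 1) # (t + 2) # qs)) (v (Suc i))"
        using v(2)[OF that] by (simp only:)
    qed (use qs z in auto)
    moreover have "exec [Loop (t + 2) [], Loop (t + 3) [Inc (t + 2)], Inc (t + 1)] (?u(t + 3 := v (Suc i))) (?s (Suc i))"
    proof -
      let ?u1 = "?u(t + 3 := v (Suc i))"
      let ?u2 = "?u1(t + 2 := 0)"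
      let ?u3 = "?u2(t + 3 := 0, t + 2 := ?u2 (t + 2) + ?u2 (t + 3))"
      have "exec [Loop (t + 2) [], Loop (t + 3) [Inc (t + 2)], Inc (t + 1)] ?u1 (?u3(t + 1 := Suc (?u3 (t + 1))))"
        by (intro exec_Cons[OF exec_clear] exec_Cons[OF exec_move] exec_Inc) simp
      moreover have "?u3(t + 1 := Suc (?u3 (t + 1))) = ?s (Suc i)"
        using z by (auto simp: fun_eq_iff)
      ultimately show ?thesis by metis
    qed
    ultimately show ?thesis by (rule exec_append)
  qed
  have 3: "exec [Loop t ?b] (?s 0) (?s n)"
    by (rule exec_Loop_iterate[where s = ?s, OF _ body]) simp_all
  have 4: "exec [Loop (t + 2) [Inc out], Loop (t + 1) []] (?s n) (s(out := y))"
  proof -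
    let ?u = "(?s n)(t + 2 := 0, out := (?s n) out + (?s n) (t + 2))"
    have "exec [Loop (t + 2) [Inc out], Loop (t + 1) []] (?s n) (?u(t + 1 := 0))"
      using Prec.prems by (intro exec_Cons[OF exec_move] exec_clear) auto
    moreover have "?u(t + 1 := 0) = s(out := y)"
      using z v(3) Prec.prems by (auto simp: fun_eq_iff)
    ultimately show ?thesis by metis
  qed
  have "exec (copy q t (t + 1) @ compile f qs (t + 2) (t + 4) @ [Loop t ?b] @ [Loop (t + 2) [Inc out], Loop (t + 1) []]) s (s(out := y))"
    using exec_append[OF 1 exec_append[OF 2 exec_append[OF 3 4]]] .
  then show ?case by (simp only: q compile.simps list.sel nth_Cons_0 append_Cons append_Nil)
next
  case (Mu f)
  from Mu.prems(1) have y0: "evals_to f (y # map s args) 0"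
    and below: "\<And>i. i < y \<Longrightarrow> \<exists>z. evals_to f (i # map s args) (Suc z)"
    by (cases rule: evals_to.cases; auto)+
  then obtain w where "\<And>i. i < y \<Longrightarrow> evals_to f (i # map s args) (Suc (w i))" by metis
  \<comment> \<open>\<open>v i\<close> is the value of \<open>f\<close> at the candidate
    \<open>i\<close>: positive below \<open>y\<close>, zero at \<open>y\<close>. Its predecessor
    \<open>w i\<close> is what the loop test leaves in register \<open>t\<close>.\<close>
  define v where "v i = (if i < y then Suc (w i) else 0)" for i
  have v: "evals_to f (i # map s args) (v i)" if "i \<le> y" for i
    using that \<open>\<And>i. i < y \<Longrightarrow> evals_to f (i # map s args) (Suc (w i))\<close> y0 by (cases "i = y") (auto simp: v_def)
  let ?c = "compile f (out # args) t (t + 1)"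
  have c: "exec ?c (s(out := i)) (s(out := i, t := v i))" if "i \<le> y" for i
  proof (rule Mu.IH)
    have "map (s(out := i)) (out # args) = i # map s args" using Mu.prems by auto
    then show "evals_to f (map (s(out := i)) (out # args)) (v i)"
      using v[OF that] by (simp only:)
  qed (use Mu.prems in auto)
  let ?b = "Loop t [] # Inc out # ?c"
  \<comment> \<open>At the loop head \<open>out\<close> holds the candidate \<open>i\<close> and
    \<open>t\<close> the value of \<open>f\<close> there; the induction is on the distance of
    \<open>i\<close> from \<open>y\<close>.\<close>
  have "exec [Loop t ?b] (s(out := i, t := v i)) (s(out := y))" if "i \<le> y" for i
    using that
  proof (induction "y - i" arbitrary: i)
    case 0
    then have "i = y" by simp
    have z: "v y = 0" by (simp add: v_def)
    have "s(out := y, t := v y) = s(out := y)" using Mu.prems z by (auto simp: fun_eq_iff)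
    moreover have "exec [Loop t ?b] (s(out := y)) (s(out := y))"
      using Mu.prems by (intro exec_Loop_0) simp
    ultimately show ?case using \<open>i = y\<close> by (simp only:)
  next
    case (Suc m)
    then have "i < y" by simp
    let ?s = "(s(out := i, t := v i))(t := w i)"
    have "exec ?b ?s (s(out := Suc i, t := v (Suc i)))"
    proof (rule exec_Cons[OF _ exec_Cons])
      show "exec [Loop t []] ?s (?s(t := 0))" by (rule exec_clear)
      have "(?s(t := 0))(out := Suc ((?s(t := 0)) out)) = s(out := Suc i)"
        using Mu.prems by (auto simp: fun_eq_iff)
      then show "exec [Inc out] (?s(t := 0)) (s(out := Suc i))"
        using exec_Inc by metis
      show "exec ?c (s(out := Suc i)) (s(out := Suc i, t := v (Suc i)))"
        by (rule c) (use \<open>i < y\<close> in simp)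
    qed
    moreover have "exec [Loop t ?b] (s(out := Suc i, t := v (Suc i))) (s(out := y))"
      by (rule Suc.hyps(1)) (use Suc in simp_all)
    moreover have "(s(out := i, t := v i)) t = Suc (w i)"
      using \<open>i < y\<close> by (simp add: v_def)
    ultimately show ?case by (metis exec_Loop_Suc)
  qed
  from this[of 0] have "exec [Loop t ?b] (s(out := 0, t := v 0)) (s(out := y))" by blast
  moreover have "s(out := 0) = s" using Mu.prems by auto
  with c[of 0] have "exec ?c s (s(out := 0, t := v 0))" by (simp only: le0)
  ultimately show ?case unfolding compile.simps by (rule exec_append[rotated])
qed

section \<open>A recursive term for instance codes\<close>

fun const_recf :: "nat \<Rightarrow> recf" where
  "const_recf 0 = Zero"
| "const_recf (Suc n) = Comp Succ [const_recf n]"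

text \<open>In the second argument of \<open>Prec\<close>, \<open>Proj 0\<close> is the recursion
  index and \<open>Proj 1\<close> the previous value. \<open>pair_recf\<close> follows
  \<open>prod_encode\<close>: the triangular number of m + n, plus m.\<close>

definition "add_recf = Prec (Proj 0) (Comp Succ [Proj 1])"
definition "triangle_recf = Prec Zero (Comp add_recf [Proj 1, Comp Succ [Proj 0]])"
definition "pair_recf = Comp add_recf [Comp triangle_recf [add_recf], Proj 0]"
definition "power_recf = Prec (const_recf 1) (Comp add_recf [Proj 1, Proj 1])"

lemma evals_to_Proj: "i < length xs \<Longrightarrow> y = xs ! i \<Longrightarrow> evals_to (Proj i) xs y"
  using evals_to.Proj by simp

lemma evals_to_Comp1: "evals_to g xs a \<Longrightarrow> evals_to f [a] z \<Longrightarrow> evals_to (Comp f [g]) xs z"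
  by (rule evals_to.Comp[where ys = "[a]"]) auto

lemma evals_to_Comp2:
  "evals_to g xs a \<Longrightarrow> evals_to h xs b \<Longrightarrow> evals_to f [a, b] z \<Longrightarrow> evals_to (Comp f [g, h]) xs z"
  by (rule evals_to.Comp[where ys = "[a, b]"]) auto

lemma evals_to_const: "evals_to (const_recf n) xs n"
  by (induction n) (auto intro: evals_to.Zero evals_to.Succ evals_to_Comp1)

lemma evals_to_add: "evals_to add_recf [m, n] (m + n)"
  unfolding add_recf_def
proof (induction m)
  case 0
  show ?case by (auto intro!: evals_to.Prec_0 evals_to_Proj)
next
  case (Suc m)
  show ?case
    by (rule evals_to.Prec_Suc[OF Suc]) (auto intro!: evals_to_Comp1 evals_to_Proj evals_to.Succ)
qed

lemma evals_to_triangle: "evals_to triangle_recf [n] (triangle n)"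
  unfolding triangle_recf_def
proof (induction n)
  case 0
  show ?case by (auto intro!: evals_to.Prec_0 evals_to.Zero)
next
  case (Suc n)
  show ?case
    by (rule evals_to.Prec_Suc[OF Suc], unfold triangle_Suc)
      (auto simp del: add_Suc_right intro!: evals_to_Comp2[OF _ _ evals_to_add] evals_to_Comp1[OF _ evals_to.Succ] evals_to_Proj)
qed

lemma evals_to_pair: "evals_to pair_recf [m, n] (prod_encode (m, n))"
  unfolding pair_recf_def prod_encode_def
  by (auto intro!: evals_to_Comp2[OF _ _ evals_to_add] evals_to_Comp1[OF evals_to_add evals_to_triangle] evals_to_Proj)

lemma evals_to_power: "evals_to power_recf [n] (2 ^ n)"
  unfolding power_recf_def
proof (induction n)
  case 0
  show ?case using evals_to.Prec_0[OF evals_to_const[of 1 "[]"]] by simp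
next
  case (Suc n)
  have "evals_to (Comp add_recf [Proj 1, Proj 1]) [n, 2 ^ n] (2 ^ n + 2 ^ n)"
    by (auto intro!: evals_to_Comp2[OF _ _ evals_to_add] evals_to_Proj)
  then show ?case using evals_to.Prec_Suc[OF Suc] by (simp add: mult_2)
qed

fun list_recf :: "recf list \<Rightarrow> recf" where
  "list_recf [] = Zero"
| "list_recf (g # gs) = Comp Succ [Comp pair_recf [g, list_recf gs]]"

lemma evals_to_list:
  "list_all2 (\<lambda>g y. evals_to g xs y) gs ys \<Longrightarrow> evals_to (list_recf gs) xs (list_encode ys)"
  by (induction rule: list_all2_induct)
    (auto intro!: evals_to.Zero evals_to.Succ evals_to_Comp1 evals_to_Comp2[OF _ _ evals_to_pair])

section \<open>Two-counter machines\<close>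

datatype 'l instr = Halt | Goto 'l | Add bool 'l | Sub bool 'l 'l

inductive machine_step :: "('l \<Rightarrow> 'l instr) \<Rightarrow> 'l \<times> nat \<times> nat \<Rightarrow> 'l \<times> nat \<times> nat \<Rightarrow> bool"
  for ins where
  Goto: "ins l = Goto m \<Longrightarrow> machine_step ins (l, a, b) (m, a, b)"
| Add_fst: "ins l = Add False m \<Longrightarrow> machine_step ins (l, a, b) (m, Suc a, b)"
| Add_snd: "ins l = Add True m \<Longrightarrow> machine_step ins (l, a, b) (m, a, Suc b)"
| Sub_fst: "ins l = Sub False m z \<Longrightarrow> machine_step ins (l, Suc a, b) (m, a, b)"
| Sub_snd: "ins l = Sub True m z \<Longrightarrow> machine_step ins (l, a, Suc b) (m, a, b)"
| Zero_fst: "ins l = Sub False m z \<Longrightarrow> machine_step ins (l, 0, b) (z, 0, b)"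
| Zero_snd: "ins l = Sub True m z \<Longrightarrow> machine_step ins (l, a, 0) (z, a, 0)"

text \<open>
  The stack of remaining operations serves as the finite control. The registers are stored as the
  exponents of distinct primes in the first counter. With \<open>P\<close> the prime of the topmost
  operation, the labels \<open>Fwd\<close> multiply (\<open>Inc\<close>) or divide (\<open>Loop\<close>) the first counter by \<open>P\<close> while
  moving it to the second one; \<open>Bk\<close> moves an exact quotient back. \<open>Ret\<close> moves a product back or, for
  \<open>Loop\<close>, undoes a division that left a remainder, which is then the initial value of its parameter.
\<close>

datatype label = Start | Fwd nat "op list" | Ret nat "op list" | Bk nat "op list"

instance op :: countable by countable_datatype
instance label :: countable by countable_datatype

definition register_prime :: "nat \<Rightarrow> nat" where
  "register_prime = enumerate {p. prime p}"

lemma prime_pr: "prime (register_prime r)"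
  using enumerate_in_set[OF primes_infinite, of r] by (simp add: register_prime_def)

lemma pr_eq_iff: "register_prime q = register_prime r \<longleftrightarrow> q = r"
  using strict_mono_enumerate[OF primes_infinite] by (simp add: register_prime_def strict_mono_eq)

text \<open>Register 0 thus belongs to the prime 2, which is why an input \<open>x\<close> enters
  the machine as \<open>2 ^ x\<close>.\<close>

lemma pr_0: "register_prime 0 = 2"
  unfolding register_prime_def enumerate_0 by (rule Least_equality) (auto dest: prime_ge_2_nat)

text \<open>For \<open>Inc\<close>, \<open>Fwd j\<close> still owes \<open>j\<close> increments to
  the second counter; for \<open>Loop\<close>, it has removed \<open>j\<close> units of the current
  group of \<open>register_prime r\<close>, so the division is exact iff the first counter runs
  empty at \<open>j = 0\<close>. The accepting label \<open>Fwd 0 []\<close> is a self-loop, so that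
  reaching it gives infinitely many visits.\<close>

fun program :: "op list \<Rightarrow> label \<Rightarrow> label instr" where
  "program p Start = Goto (Fwd 0 p)"
| "program p (Fwd j []) = Goto (Fwd 0 [])"
| "program p (Fwd j (Inc r # k)) =
     (if j = 0 then Sub False (Fwd (register_prime r) (Inc r # k)) (Ret 0 (Inc r # k))
      else Add True (Fwd (j - 1) (Inc r # k)))"
| "program p (Ret j (Inc r # k)) =
     (if j = 0 then Sub True (Ret 1 (Inc r # k)) (Fwd 0 k) else Add False (Ret (j - 1) (Inc r # k)))"
| "program p (Fwd j (Loop r b # k)) =
     (if j < register_prime r
      then Sub False (Fwd (Suc j) (Loop r b # k)) (if j = 0 then Bk 0 (Loop r b # k) else Ret j (Loop r b # k))
      else Add True (Fwd 0 (Loop r b # k)))"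
| "program p (Ret j (Loop r b # k)) =
     (if j = 0 then Sub True (Ret (register_prime r) (Loop r b # k)) (Fwd 0 k) else Add False (Ret (j - 1) (Loop r b # k)))"
| "program p (Bk j (Loop r b # k)) =
     (if j = 0 then Sub True (Bk 1 (Loop r b # k)) (Fwd 0 (b @ Loop r b # k))
      else Add False (Bk (j - 1) (Loop r b # k)))"
| "program p l = Halt"

abbreviation program_steps where
  "program_steps p \<equiv> (machine_step (program p))\<^sup>*\<^sup>*"

section \<open>Runs of the machine on a single operation\<close>

lemma Inc_Fwd:
  "program_steps p (Fwd j (Inc r # k), a, b) (Fwd 0 (Inc r # k), a, b + j)"
proof (induction j arbitrary: b)
  case (Suc j)
  have "machine_step (program p) (Fwd (Suc j) (Inc r # k), a, b) (Fwd j (Inc r # k), a, Suc b)"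
    by (rule Add_snd) simp
  with Suc[of "Suc b"] show ?case by (auto intro: converse_rtranclp_into_rtranclp)
qed simp

lemma Inc_mult:
  "program_steps p (Fwd 0 (Inc r # k), a, b) (Ret 0 (Inc r # k), 0, b + a * register_prime r)"
proof (induction a arbitrary: b)
  case 0
  have "machine_step (program p) (Fwd 0 (Inc r # k), 0, b) (Ret 0 (Inc r # k), 0, b)"
    by (rule Zero_fst) simp
  then show ?case by auto
next
  case (Suc a)
  have "machine_step (program p) (Fwd 0 (Inc r # k), Suc a, b) (Fwd (register_prime r) (Inc r # k), a, b)"
    by (rule Sub_fst) simp
  also note Inc_Fwd
  also note Suc
  finally show ?case by (simp add: algebra_simps)
qed

lemma Inc_Ret:
  "program_steps p (Ret 0 (Inc r # k), a, b) (Fwd 0 k, a + b, 0)"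
proof (induction b arbitrary: a)
  case 0
  have "machine_step (program p) (Ret 0 (Inc r # k), a, 0) (Fwd 0 k, a, 0)"
    by (rule Zero_snd) simp
  then show ?case by auto
next
  case (Suc b)
  have "program_steps p (Ret 0 (Inc r # k), a, Suc b) (Ret 1 (Inc r # k), a, b)"
    by (rule r_into_rtranclp, rule Sub_snd) simp
  also have "machine_step (program p) \<dots> (Ret 0 (Inc r # k), Suc a, b)"
    by (rule Add_fst) simp
  also note Suc
  finally show ?case by simp
qed

lemma Loop_Ret_Suc:
  "program_steps p (Ret j (Loop r c # k), a, b) (Ret 0 (Loop r c # k), a + j, b)"
proof (induction j arbitrary: a)
  case (Suc j)
  have "machine_step (program p) (Ret (Suc j) (Loop r c # k), a, b) (Ret j (Loop r c # k), Suc a, b)"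
    by (rule Add_fst) simp
  with Suc[of "Suc a"] show ?case by (auto intro: converse_rtranclp_into_rtranclp)
qed simp

lemma Loop_Ret:
  "program_steps p (Ret 0 (Loop r c # k), a, b) (Fwd 0 k, a + b * register_prime r, 0)"
proof (induction b arbitrary: a)
  case 0
  have "machine_step (program p) (Ret 0 (Loop r c # k), a, 0) (Fwd 0 k, a, 0)"
    by (rule Zero_snd) simp
  then show ?case by auto
next
  case (Suc b)
  have "machine_step (program p) (Ret 0 (Loop r c # k), a, Suc b) (Ret (register_prime r) (Loop r c # k), a, b)"
    by (rule Sub_snd) simp
  also note Loop_Ret_Suc
  also note Suc
  finally show ?case by (simp add: algebra_simps)
qed

lemma Loop_Bk:
  "program_steps p (Bk 0 (Loop r c # k), a, b) (Fwd 0 (c @ Loop r c # k), a + b, 0)"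
proof (induction b arbitrary: a)
  case 0
  have "machine_step (program p) (Bk 0 (Loop r c # k), a, 0) (Fwd 0 (c @ Loop r c # k), a, 0)"
    by (rule Zero_snd) simp
  then show ?case by auto
next
  case (Suc b)
  have "program_steps p (Bk 0 (Loop r c # k), a, Suc b) (Bk 1 (Loop r c # k), a, b)"
    by (rule r_into_rtranclp, rule Sub_snd) simp
  also have "machine_step (program p) \<dots> (Bk 0 (Loop r c # k), Suc a, b)"
    by (rule Add_fst) simp
  also note Suc
  finally show ?case by simp
qed

lemma Loop_Fwd_mod:
  "i + j \<le> register_prime r \<Longrightarrow> program_steps p (Fwd i (Loop r c # k), a + j, b) (Fwd (i + j) (Loop r c # k), a, b)"
proof (induction j arbitrary: i)
  case (Suc j)
  have "machine_step (program p) (Fwd i (Loop r c # k), Suc (a + j), b) (Fwd (Suc i) (Loop r c # k), a + j, b)"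
    by (rule Sub_fst) (use Suc in simp)
  also have "program_steps p \<dots> (Fwd (Suc i + j) (Loop r c # k), a, b)"
    using Suc.IH[of "Suc i"] Suc.prems by simp
  finally show ?case by simp
qed simp

lemma Loop_Fwd_div:
  "program_steps p (Fwd 0 (Loop r c # k), a, b)
    (Fwd (a mod register_prime r) (Loop r c # k), 0, b + a div register_prime r)"
proof (induction a arbitrary: b rule: less_induct)
  case (less a)
  show ?case
  proof (cases "a < register_prime r")
    case True
    then show ?thesis using Loop_Fwd_mod[of 0 a r p c k 0 b] by simp
  next
    case False
    have pos: "register_prime r > 0" using prime_gt_0_nat[OF prime_pr] .
    define n where "n = a - register_prime r"
    have n: "a = n + register_prime r" "n < a" using False pos by (auto simp: n_def)
    have "program_steps p (Fwd 0 (Loop r c # k), a, b) (Fwd (register_prime r) (Loop r c # k), n, b)"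
      using Loop_Fwd_mod[of 0 "register_prime r" r p c k n b] n by simp
    also have "machine_step (program p) \<dots> (Fwd 0 (Loop r c # k), n, Suc b)"
      by (rule Add_snd) simp
    also note less.IH[OF n(2)]
    finally show ?thesis using pos by (simp add: n(1))
  qed
qed

section \<open>Simulation of loop programs on Goedel numbers\<close>

definition godel :: "(nat \<Rightarrow> nat) \<Rightarrow> nat \<Rightarrow> bool" where
  "godel s N \<longleftrightarrow> N > 0 \<and> (\<forall>r. multiplicity (register_prime r) N = s r)"

lemma multiplicity_pr_mult:
  "N > 0 \<Longrightarrow> multiplicity (register_prime q) (N * register_prime r) = multiplicity (register_prime q) N + of_bool (q = r)"
  using prime_pr[of q] prime_pr[of r] prime_gt_0_nat[OF prime_pr[of r]]
  by (cases "q = r")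
    (auto simp: prime_elem_multiplicity_mult_distrib prime_multiplicity_other pr_eq_iff multiplicity_same_power[of "register_prime r" 1, simplified])

text \<open>Incrementing a register multiplies \<open>N\<close> by its prime, a zero test is a test
  for divisibility, and a decrement is an exact division.\<close>

lemma program_simulates_step:
  assumes "op_step (k, s) (k', s')" "godel s N"
  shows "\<exists>N'. godel s' N' \<and> program_steps p (Fwd 0 k, N, 0) (Fwd 0 k', N', 0)"
  using assms(1)
proof cases
  case (Inc r)
  have "godel s' (N * register_prime r)"
    using assms(2) prime_gt_0_nat[OF prime_pr] Inc(2) by (auto simp: godel_def multiplicity_pr_mult)
  moreover have "program_steps p (Fwd 0 k, N, 0) (Fwd 0 k', N * register_prime r, 0)"
    using rtranclp_trans[OF Inc_mult Inc_Ret, of p r k' N 0] Inc by simp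
  ultimately show ?thesis by blast
next
  case (Loop_0 r b)
  have "multiplicity (register_prime r) N = 0" "N > 0" using assms(2) Loop_0 by (auto simp: godel_def)
  then have "\<not> register_prime r dvd N"
    using prime_pr[of r] by (subst (asm) multiplicity_eq_zero_iff) auto
  \<comment> \<open>The remainder is nonzero, so the empty counter leads to \<open>Ret\<close>,
    which rebuilds \<open>N\<close> from remainder and quotient.\<close>
  then have nz: "N mod register_prime r \<noteq> 0" by (simp add: dvd_eq_mod_eq_0)
  have "program_steps p (Fwd 0 k, N, 0) (Fwd (N mod register_prime r) k, 0, N div register_prime r)"
    using Loop_Fwd_div[of p r b k' N 0] Loop_0 by simp
  also have "machine_step (program p) \<dots> (Ret (N mod register_prime r) k, 0, N div register_prime r)"
    unfolding Loop_0 by (rule Zero_fst) (use nz prime_gt_0_nat[OF prime_pr] in simp)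
  also have "program_steps p \<dots> (Ret 0 k, N mod register_prime r, N div register_prime r)"
    unfolding Loop_0 using Loop_Ret_Suc[of p "N mod register_prime r" r b k' 0] by simp
  also have "program_steps p \<dots> (Fwd 0 k', N mod register_prime r + N div register_prime r * register_prime r, 0)"
    unfolding Loop_0 by (rule Loop_Ret)
  finally show ?thesis using assms(2) Loop_0 by auto
next
  case (Loop_Suc r n b k0)
  have "register_prime r dvd N"
    using assms(2) Loop_Suc not_dvd_imp_multiplicity_0[of "register_prime r" N] by (auto simp: godel_def)
  then obtain N' where N': "N = N' * register_prime r" by (metis dvdE mult.commute)
  then have pos: "N' > 0" using assms(2) by (cases N') (auto simp: godel_def)
  have mult: "multiplicity (register_prime q) N = multiplicity (register_prime q) N' + of_bool (q = r)" for q
    unfolding N' using multiplicity_pr_mult[OF pos] .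
  have "multiplicity (register_prime q) N' = s' q" for q
  proof -
    have "multiplicity (register_prime q) N = s q" using assms(2) by (simp add: godel_def)
    then show ?thesis using mult[of q] Loop_Suc(2-4) by (cases "q = r") simp_all
  qed
  then have "godel s' N'" using pos by (simp add: godel_def)
  moreover have "program_steps p (Fwd 0 k, N, 0) (Fwd 0 k', N', 0)"
  proof -
    have "program_steps p (Fwd 0 k, N, 0) (Fwd 0 k, 0, N')"
      using Loop_Fwd_div[of p r b k0 N 0] Loop_Suc prime_gt_0_nat[OF prime_pr[of r]] N' by simp
    also have "machine_step (program p) \<dots> (Bk 0 k, 0, N')"
      unfolding Loop_Suc by (rule Zero_fst) (use prime_gt_0_nat[OF prime_pr] in simp)
    also have "program_steps p \<dots> (Fwd 0 k', N', 0)"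
      unfolding Loop_Suc using Loop_Bk[of p r b k0 0 N'] by simp
    finally show ?thesis .
  qed
  ultimately show ?thesis by blast
qed

lemma program_simulates:
  assumes "op_step\<^sup>*\<^sup>* (k, s) (k', s')" "godel s N"
  shows "\<exists>N'. godel s' N' \<and> program_steps p (Fwd 0 k, N, 0) (Fwd 0 k', N', 0)"
  using assms(1)
proof (induction rule: rtranclp_induct2)
  case refl
  then show ?case using assms(2) by auto
next
  case (step k1 s1 k2 s2)
  then show ?case using program_simulates_step by (meson rtranclp_trans)
qed

lemma machine_step_deterministic: "machine_step ins c d \<Longrightarrow> machine_step ins c d' \<Longrightarrow> d = d'"
  by (auto elim!: machine_step.cases)

text \<open>The run from \<open>c\<close> is unique, so every configuration reached lies on the way
  to the halted \<open>d\<close>. This excludes acceptance once \<open>Stop\<close> is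
  reached.\<close>

lemma machine_steps_to_halted:
  assumes "(machine_step ins)\<^sup>*\<^sup>* c d" "(machine_step ins)\<^sup>*\<^sup>* c (l, a, b)" "\<And>d'. \<not> machine_step ins d d'"
  shows "(machine_step ins)\<^sup>*\<^sup>* (l, a, b) d"
  using assms(1,2)
proof (induction rule: converse_rtranclp_induct)
  case base
  then show ?case using assms(3) by (metis converse_rtranclpE rtranclp.rtrancl_refl)
next
  case (step c c')
  from step(4) show ?case
  proof (cases rule: converse_rtranclpE)
    case base
    then show ?thesis using step(1,2) by (metis converse_rtranclp_into_rtranclp)
  next
    case (step y)
    then show ?thesis using step.IH machine_step_deterministic \<open>machine_step ins c c'\<close> by metis
  qed
qed

section \<open>A finite set of labels closed under the program\<close>

text \<open>
  A finite set containing the operation stacks that occur when \<open>xs @ k\<close> is run down to \<open>k\<close>.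
\<close>

fun stacks :: "op list \<Rightarrow> op list \<Rightarrow> op list set" where
  "stacks [] k = {k}"
| "stacks (Inc r # xs) k = insert (Inc r # xs @ k) (stacks xs k)"
| "stacks (Loop r b # xs) k =
     insert (Loop r b # xs @ k) (stacks b (Loop r b # xs @ k) \<union> stacks xs k)"
| "stacks (Stop # xs) k = insert (Stop # xs @ k) (stacks xs k)"

lemma append_in_stacks: "xs @ k \<in> stacks xs k"
  by (induction xs k rule: stacks.induct) auto

lemma end_in_stacks: "k \<in> stacks xs k"
  by (induction xs k rule: stacks.induct) auto

lemma finite_stacks: "finite (stacks xs k)"
  by (induction xs k rule: stacks.induct) auto

fun next_stacks :: "op list \<Rightarrow> op list set" where
  "next_stacks (Inc r # k) = {k}"
| "next_stacks (Loop r b # k) = {k, b @ Loop r b # k}"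
| "next_stacks k = {}"

text \<open>The body of a loop is run down to the loop itself. This is the stack excepted in the
  induction hypothesis for the body, and \<open>append_in_stacks\<close> puts both of its successors
  into the set.\<close>

lemma next_stacks_subset: "y \<in> stacks xs k \<Longrightarrow> y \<noteq> k \<Longrightarrow> next_stacks y \<subseteq> stacks xs k"
proof (induction xs k rule: stacks.induct)
  case (3 r b xs k)
  then show ?case
    using append_in_stacks[of xs k] append_in_stacks[of b "Loop r b # xs @ k"] by fastforce
qed (use append_in_stacks in auto)

fun max_phase :: "op list \<Rightarrow> nat" where
  "max_phase (Inc r # k) = register_prime r"
| "max_phase (Loop r b # k) = register_prime r"
| "max_phase k = 0"

text \<open>The control states of the game must be finitely many. Only finitely many stacks occur,
  and a phase never exceeds the prime of the topmost operation.\<close>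

definition labels :: "op list \<Rightarrow> label set" where
  "labels p = insert Start (\<Union>k\<in>stacks p []. \<Union>j\<le>max_phase k. {Fwd j k, Ret j k, Bk j k})"

lemma finite_labels: "finite (labels p)"
  by (simp add: labels_def finite_stacks)

fun targets :: "'l instr \<Rightarrow> 'l set" where
  "targets Halt = {}"
| "targets (Goto m) = {m}"
| "targets (Add c m) = {m}"
| "targets (Sub c m z) = {m, z}"

lemma targets_program:
  assumes "l \<in> labels p"
  shows "targets (program p l) \<subseteq> labels p"
proof -
  \<comment> \<open>The excepted stack \<open>[]\<close> has no successors.\<close>
  have next_in: "k' \<in> stacks p []" if "k \<in> stacks p []" "k' \<in> next_stacks k" for k k'
    using next_stacks_subset[OF that(1)] that(2) by (cases "k = []") auto
  have p: "p \<in> stacks p []" "[] \<in> stacks p []"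
    using append_in_stacks[of p "[]"] end_in_stacks by simp_all
  \<comment> \<open>Phase 1 occurs in \<open>Ret\<close> and \<open>Bk\<close>, so the bound has to
    be at least 1.\<close>
  have pos: "Suc 0 \<le> register_prime r" for r using prime_gt_0_nat[OF prime_pr] by (simp add: Suc_leI)
  show ?thesis
    using assms p pos
    by (cases "(p, l)" rule: program.cases) (auto simp: labels_def dest: next_in split: if_splits)
qed
section \<open>Plays and their probabilities\<close>

text \<open>Course-of-values recursion, obtained by building the list of earlier values by primitive
  recursion. Plays need it because a strategy sees the whole history.\<close>

lemma prefix_recursion: "\<exists>f :: nat \<Rightarrow> 'a. \<forall>n. f n = F (map f [0..<n])"
proof -
  define g where "g = rec_nat [] (\<lambda>_ xs. xs @ [F xs])"
  have g: "g 0 = []" "g (Suc n) = g n @ [F (g n)]" for n by (simp_all add: g_def)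
  have "map (\<lambda>n. F (g n)) [0..<n] = g n" for n by (induction n) (simp_all add: g)
  then show ?thesis by (intro exI[of _ "\<lambda>n. F (g n)"]) simp
qed

lemma history_Suc: "history \<omega> (Suc i) = history \<omega> i @ [the (\<omega> (Suc i))]"
  by (simp add: history_def)

lemma last_history: "last (history \<omega> i) = the (\<omega> i)"
  by (simp add: history_def)

text \<open>\<open>pick\<close> resolves the probabilistic choices and the strategy those of Player
  1, which determines one play.\<close>

lemma outcome_exists:
  assumes c: "c \<in> confs M" and \<sigma>: "\<sigma> \<in> strategies M"
    and confs: "\<And>c c'. step M c c' \<Longrightarrow> c' \<in> confs M"
    and pick: "\<And>d. \<not> deadlock M d \<Longrightarrow> step M d (pick d)"
  shows "\<exists>\<omega>\<in>outcome M c \<sigma>. \<forall>n d. \<omega> n = Some d \<longrightarrow> d \<notin> player_confs M \<longrightarrow> \<not> deadlock M d \<longrightarrow>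
    \<omega> (Suc n) = Some (pick d)"
proof -
  define F where "F xs = (if xs = [] then Some c else case last xs of None \<Rightarrow> None
      | Some d \<Rightarrow> if deadlock M d then None
          else Some (if d \<in> player_confs M then \<sigma> (map the xs) else pick d))" for xs
  obtain \<omega> where \<omega>: "\<And>n. \<omega> n = F (map \<omega> [0..<n])"
    using prefix_recursion[of F] by blast
  have \<omega>_0: "\<omega> 0 = Some c" by (subst \<omega>) (simp add: F_def)
  have \<omega>_Suc: "\<omega> (Suc n) = (case \<omega> n of None \<Rightarrow> None
      | Some d \<Rightarrow> if deadlock M d then None
          else Some (if d \<in> player_confs M then \<sigma> (history \<omega> n) else pick d))" for n
    by (subst \<omega>) (simp add: F_def history_def comp_def split: option.split)
  \<comment> \<open>\<open>strategies\<close> constrains \<open>\<sigma>\<close> only on finite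
    plays, hence the condition on the history, which \<open>play\<close> establishes by
    induction.\<close>
  have *: "step M d (if d \<in> player_confs M then \<sigma> (history \<omega> n) else pick d)"
    if "finite_play M (history \<omega> n)" "\<omega> n = Some d" "\<not> deadlock M d" for n d
    using that \<sigma> pick by (auto simp: strategies_def last_history)
  have play: "\<omega> n = Some d \<Longrightarrow> finite_play M (history \<omega> n)" for n d
  proof (induction n arbitrary: d)
    case 0
    then show ?case using c \<omega>_0 by (simp add: history_def finite_play_def)
  next
    case (Suc n)
    obtain d' where d': "\<omega> n = Some d'" "\<not> deadlock M d'"
      using Suc.prems by (auto simp: \<omega>_Suc split: option.splits if_splits)
    then have "step M d' d" using *[OF Suc.IH[OF d'(1)] d'] Suc.prems by (simp add: \<omega>_Suc)
    then show ?case
      using Suc.IH[OF d'(1)] confs[of d' d] last_history[of \<omega> n] d'(1) Suc.prems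
      by (auto simp: finite_play_def history_Suc successively_append_iff)
  qed
  have "maximal_play M \<omega>"
    unfolding maximal_play_def using c \<omega>_0 *[OF play] by (auto simp: \<omega>_Suc split: option.splits)
  then show ?thesis
    by (intro bexI[of _ \<omega>]) (auto simp: outcome_def \<omega>_0 \<omega>_Suc split: if_splits)
qed

lemma sets_cylinder:
  fixes M :: "'c :: countable mdp"
  shows "{\<omega>. \<forall>i<n. \<omega> i = w i} \<in> sets (play_measure M c \<sigma>)"
proof -
  have "{\<omega>. \<forall>i<n. \<omega> i = w i} = {\<omega> \<in> space (play_measure M c \<sigma>). \<forall>i\<in>{..<n}. \<omega> i = w i}" by auto
  also have "\<dots> \<in> sets (play_measure M c \<sigma>)" by measurable
  finally show ?thesis .
qed

lemma Inter_cylinders: "(\<Inter>n. {\<omega>. \<forall>i<n. \<omega> i = w i}) = {w :: nat \<Rightarrow> 'a}"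
  by (auto simp: fun_eq_iff)

lemma sets_play_singleton:
  fixes M :: "'c :: countable mdp"
  shows "{w} \<in> sets (play_measure M c \<sigma>)"
  unfolding Inter_cylinders[of w, symmetric]
  using sets.top[of "play_measure M c \<sigma>"] by (intro sets.countable_INT'' sets_cylinder) simp_all

text \<open>The singleton is the intersection of the decreasing cylinders, so the bound carries over
  by continuity from above.\<close>

lemma measure_play_singleton_ge:
  fixes M :: "'c :: countable mdp"
  assumes "\<And>n. a \<le> measure (play_measure M c \<sigma>) {\<omega>. \<forall>i<n. \<omega> i = w i}"
  shows "a \<le> measure (play_measure M c \<sigma>) {w}"
proof -
  interpret prob_space "play_measure M c \<sigma>" by (rule prob_space_play_measure)
  have "(\<lambda>n. measure (play_measure M c \<sigma>) {\<omega>. \<forall>i<n. \<omega> i = w i}) \<longlonglongrightarrow>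
      measure (play_measure M c \<sigma>) (\<Inter>n. {\<omega>. \<forall>i<n. \<omega> i = w i})"
    by (rule finite_Lim_measure_decseq) (auto simp: sets_cylinder decseq_def)
  then show ?thesis using assms by (intro LIMSEQ_le_const) (auto simp: Inter_cylinders)
qed

lemma outcome_Suc:
  assumes "\<omega> \<in> outcome M c \<sigma>"
  obtains "\<omega> n = None" "\<omega> (Suc n) = None"
  | d where "\<omega> n = Some d" "deadlock M d" "\<omega> (Suc n) = None"
  | d d' where "\<omega> n = Some d" "step M d d'" "\<omega> (Suc n) = Some d'"
      "d \<in> player_confs M \<Longrightarrow> d' = \<sigma> (history \<omega> n)"
  using assms by (fastforce simp: outcome_def maximal_play_def split: option.splits if_splits dest: spec[of _ n])

text \<open>With unit weights all enabled transitions of a probabilistic configuration are equally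
  likely; several may lead to the same successor, hence an inequality. Deadlocks and moves of Player
  1 have probability 1.\<close>

lemma next_pmf_ge:
  assumes S: "vass_mdp d S" "\<And>t. t \<in> transitions S \<Longrightarrow> weight S t = 1"
    and \<omega>: "\<omega> \<in> outcome (induced_mdp d S) c \<sigma>"
    and k: "k \<ge> 1" "\<And>x. \<omega> n = Some x \<Longrightarrow> x \<notin> player_confs (induced_mdp d S) \<Longrightarrow> card (enabled_transitions S x) \<le> k"
  shows "1 / real k \<le> pmf (next_pmf (induced_mdp d S) c \<sigma> (Suc n) \<omega>) (\<omega> (Suc n))"
  using \<omega>
proof (cases rule: outcome_Suc[of _ _ _ _ n])
  case 1
  then show ?thesis using k by simp
next
  case (2 x)
  then show ?thesis using k by simp
next
  case (3 x y)
  let ?M = "induced_mdp d S"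
  have nd: "\<not> deadlock ?M x" using 3 unfolding deadlock_def by blast
  show ?thesis
  proof (cases "x \<in> player_confs ?M")
    case True
    then show ?thesis using 3 nd k by simp
  next
    case False
    let ?E = "enabled_transitions S x"
    have fin: "finite ?E" using S by (auto simp: enabled_transitions_def vass_mdp_def)
    obtain t where t: "t \<in> ?E" "y = fire t x" using 3 by (auto simp: induced_mdp_def)
    have w: "weight S t = 1" if "t \<in> ?E" for t using that S(2) by (auto simp: enabled_transitions_def)
    have card: "card ?E > 0" using t fin by (auto simp: card_gt_0_iff)
    have "1 / real k \<le> 1 / real (card ?E)"
      using k(2) 3 False card by (simp add: frac_le)
    also have "1 \<le> (\<Sum>t | t \<in> ?E \<and> fire t x = y. real (weight S t))"
      using member_le_sum[of t "{t \<in> ?E. fire t x = y}" "\<lambda>t. real (weight S t)"] t w fin by simp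
    then have "1 / real (card ?E) \<le> trans_prob ?M x y"
      using w by (simp add: induced_mdp_def divide_right_mono)
    also have "\<dots> = pmf (next_pmf ?M c \<sigma> (Suc n) \<omega>) (\<omega> (Suc n))"
      using 3 nd False pmf_embed_pmf_induced_mdp[OF S(1) nd] by (simp add: pmf_map_inj')
    finally show ?thesis .
  qed
qed

section \<open>The game of a machine\<close>

text \<open>
  At a zero test \<open>Yes l\<close> and \<open>No l\<close> are the claims that the counter is nonzero and zero.
\<close>

datatype 'l node = Sink | Node 'l | Yes 'l | No 'l

instance node :: (countable) countable by countable_datatype

fun unit_vector :: "bool \<Rightarrow> int \<Rightarrow> int list" where
  "unit_vector c k = (if c then [0, k] else [k, 0])"

fun moves :: "('l \<Rightarrow> 'l instr) \<Rightarrow> 'l node \<Rightarrow> (int list \<times> 'l node) set" where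
  "moves ins Sink = {}"
| "moves ins (Node l) = (case ins l of
     Halt \<Rightarrow> {}
   | Goto m \<Rightarrow> {([0, 0], Node m)}
   | Add c m \<Rightarrow> {(unit_vector c 1, Node m)}
   | Sub c m z \<Rightarrow> {([0, 0], Yes l), ([0, 0], No l)})"
| "moves ins (Yes l) = (case ins l of Sub c m z \<Rightarrow> {(unit_vector c (- 1), Node m)} | _ \<Rightarrow> {})"
| "moves ins (No l) = (case ins l of
     Sub c m z \<Rightarrow> {([0, 0], Node z), (unit_vector c (- 1), Sink)} | _ \<Rightarrow> {})"

definition nodes :: "'l set \<Rightarrow> 'l node set" where
  "nodes L = insert Sink (Node ` L \<union> Yes ` L \<union> No ` L)"

definition player_nodes :: "('l \<Rightarrow> 'l instr) \<Rightarrow> 'l set \<Rightarrow> 'l node set" where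
  "player_nodes ins L = {Node l | l. l \<in> L \<and> (\<exists>c m z. ins l = Sub c m z)}"

definition game_transitions :: "('l::countable \<Rightarrow> 'l instr) \<Rightarrow> 'l set \<Rightarrow> nat transition set" where
  "game_transitions ins L = {(to_nat x, z, to_nat y) | x z y. x \<in> nodes L \<and> (z, y) \<in> moves ins x}"

definition game :: "('l::countable \<Rightarrow> 'l instr) \<Rightarrow> 'l set \<Rightarrow> nat vass" where
  "game ins L = \<lparr>states = to_nat ` nodes L, player_states = to_nat ` player_nodes ins L,
     prob_states = to_nat ` (nodes L - player_nodes ins L), transitions = game_transitions ins L,
     weight = (\<lambda>t\<in>game_transitions ins L. 1)\<rparr>"

section \<open>The game as a P-VASS-MDP\<close>

locale machine_game =
  fixes ins :: "'l::countable \<Rightarrow> 'l instr" and L :: "'l set"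
  assumes finite_L: "finite L"
    and targets_L: "l \<in> L \<Longrightarrow> targets (ins l) \<subseteq> L"
begin

lemma finite_moves: "finite (moves ins x)"
  by (cases x) (auto split: instr.split)

lemma moves_nodes: "x \<in> nodes L \<Longrightarrow> (z, y) \<in> moves ins x \<Longrightarrow> y \<in> nodes L"
  using targets_L by (cases x) (fastforce simp: nodes_def split: instr.splits)+

lemma moves_length: "(z, y) \<in> moves ins x \<Longrightarrow> length z = 2"
proof -
  have [simp]: "length (unit_vector c k) = 2" for c k by (cases c) auto
  show "(z, y) \<in> moves ins x \<Longrightarrow> length z = 2" by (cases x) (auto split: instr.splits)
qed

lemma finite_nodes: "finite (nodes L)"
  using finite_L by (simp add: nodes_def)

lemma finite_game_transitions: "finite (game_transitions ins L)"
proof -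
  have "game_transitions ins L = (\<Union>x\<in>nodes L. (\<lambda>(z, y). (to_nat x, z, to_nat y)) ` moves ins x)"
    by (auto simp: game_transitions_def)
  then show ?thesis using finite_nodes finite_moves by auto
qed

abbreviation M where "M \<equiv> induced_mdp 2 (game ins L)"

lemma player_nodes_subset: "player_nodes ins L \<subseteq> nodes L"
  by (auto simp: player_nodes_def nodes_def)

lemma p_vass_mdp_game: "p_vass_mdp 2 (game ins L)"
proof -
  have "player_states (game ins L) \<union> prob_states (game ins L) = states (game ins L)"
    using player_nodes_subset by (auto simp: game_def)
  moreover have "player_states (game ins L) \<inter> prob_states (game ins L) = {}"
    by (auto simp: game_def)
  moreover have "transitions (game ins L) \<subseteq> states (game ins L) \<times> {z. length z = 2} \<times> states (game ins L)"
    using moves_nodes moves_length by (auto simp: game_def game_transitions_def)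
  moreover have "z = replicate 2 0" if "(q, z, q') \<in> transitions (game ins L)" "q \<in> player_states (game ins L)" for q z q'
    using that by (auto simp: game_def game_transitions_def player_nodes_def numeral_2_eq_2)
  ultimately show ?thesis
    using finite_nodes finite_game_transitions
    unfolding p_vass_mdp_def vass_mdp_def by (auto simp: game_def)
qed

lemma vass_mdp_game: "vass_mdp 2 (game ins L)"
  using p_vass_mdp_game by (simp add: p_vass_mdp_def)

lemma confs_M: "confs M = {(to_nat x, [a, b]) | x a b. x \<in> nodes L}"
  by (auto simp: induced_mdp_def game_def length_Suc_conv numeral_2_eq_2)

lemma player_confs_M: "(to_nat x, [a, b]) \<in> player_confs M \<longleftrightarrow> x \<in> player_nodes ins L"
  by (auto simp: induced_mdp_def game_def)

definition enabled_moves :: "'l node \<Rightarrow> nat \<Rightarrow> nat \<Rightarrow> (int list \<times> 'l node) set" where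
  "enabled_moves x a b = {(z, y) \<in> moves ins x. list_all2 (\<lambda>n k. 0 \<le> int n + k) [a, b] z}"

lemma enabled_transitions_game:
  "x \<in> nodes L \<Longrightarrow> enabled_transitions (game ins L) (to_nat x, [a, b]) =
    (\<lambda>(z, y). (to_nat x, z, to_nat y)) ` enabled_moves x a b"
  by (auto simp: enabled_transitions_def game_def game_transitions_def enabled_moves_def)

lemma card_enabled_le:
  "x \<in> nodes L \<Longrightarrow> card (enabled_transitions (game ins L) (to_nat x, [a, b])) \<le> card (enabled_moves x a b)"
  unfolding enabled_transitions_game
  by (intro card_image_le finite_subset[OF _ finite_moves[of x]]) (auto simp: enabled_moves_def)

text \<open>A set rather than a pair: emptiness is the zero test, and in \<open>succs\<close> a
  blocked decrement just contributes no successor.\<close>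

fun dec :: "bool \<Rightarrow> nat \<times> nat \<Rightarrow> (nat \<times> nat) set" where
  "dec c (a, b) =
     (if c then if b = 0 then {} else {(a, b - 1)} else if a = 0 then {} else {(a - 1, b)})"

fun inc :: "bool \<Rightarrow> nat \<times> nat \<Rightarrow> nat \<times> nat" where
  "inc c (a, b) = (if c then (a, Suc b) else (Suc a, b))"

fun succs :: "'l node \<Rightarrow> nat \<times> nat \<Rightarrow> ('l node \<times> nat \<times> nat) set" where
  "succs Sink v = {}"
| "succs (Node l) v = (case ins l of
     Halt \<Rightarrow> {}
   | Goto m \<Rightarrow> {(Node m, v)}
   | Add c m \<Rightarrow> {(Node m, inc c v)}
   | Sub c m z \<Rightarrow> {(Yes l, v), (No l, v)})"
| "succs (Yes l) v = (case ins l of Sub c m z \<Rightarrow> Pair (Node m) ` dec c v | _ \<Rightarrow> {})"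
| "succs (No l) v = (case ins l of Sub c m z \<Rightarrow> insert (Node z, v) (Pair Sink ` dec c v) | _ \<Rightarrow> {})"

lemma step_M_iff:
  assumes "x \<in> nodes L"
  shows "step M (to_nat x, [a, b]) d \<longleftrightarrow> (\<exists>y a' b'. (y, a', b') \<in> succs x (a, b) \<and> d = (to_nat y, [a', b']))"
proof -
  have "(to_nat x, [a, b]) \<in> states (game ins L) \<times> {v. length v = 2}"
    using assms by (simp add: game_def)
  then have "step M (to_nat x, [a, b]) d \<longleftrightarrow>
      (\<exists>t\<in>enabled_transitions (game ins L) (to_nat x, [a, b]). d = fire t (to_nat x, [a, b]))"
    by (simp add: induced_mdp_def)
  also have "\<dots> \<longleftrightarrow> (\<exists>(z, y)\<in>enabled_moves x a b. d = fire (to_nat x, z, to_nat y) (to_nat x, [a, b]))"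
    unfolding enabled_transitions_game[OF assms] by (simp add: split_beta)
  also have "\<dots> \<longleftrightarrow> (\<exists>y a' b'. (y, a', b') \<in> succs x (a, b) \<and> d = (to_nat y, [a', b']))"
  proof -
    show ?thesis
    proof (cases x)
      case (Node l)
      then show ?thesis
        by (cases "ins l") (auto simp: enabled_moves_def nat_add_distrib)
    next
      case (Yes l)
      then show ?thesis
        by (cases "ins l") (auto simp: enabled_moves_def nat_diff_distrib)
    next
      case (No l)
      then show ?thesis
        by (cases "ins l") (auto simp: enabled_moves_def nat_diff_distrib)
    qed (simp add: enabled_moves_def)
  qed
  finally show ?thesis .
qed

lemma step_M_confs: "step M d d' \<Longrightarrow> d' \<in> confs M"
proof -
  assume step: "step M d d'"
  then obtain t where t: "t \<in> enabled_transitions (game ins L) d" "d' = fire t d" "length (snd d) = 2"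
    by (auto simp: induced_mdp_def)
  then show "d' \<in> confs M"
    using vass_mdp_game by (cases t; cases d) (auto simp: induced_mdp_def enabled_transitions_def vass_mdp_def)
qed

text \<open>A false claim of zero. Only here is more than one transition enabled in a probabilistic
  configuration, so only here does chance matter.\<close>

definition cheating :: "'l node \<Rightarrow> nat \<times> nat \<Rightarrow> bool" where
  "cheating x v \<longleftrightarrow> (\<exists>l c m z. x = No l \<and> ins l = Sub c m z \<and> dec c v \<noteq> {})"

lemma card_enabled_le_2:
  assumes "x \<in> nodes L"
  shows "card (enabled_transitions (game ins L) (to_nat x, [a, b])) \<le> 2"
proof -
  have "card (enabled_moves x a b) \<le> card (moves ins x)"
    by (intro card_mono finite_moves) (auto simp: enabled_moves_def)
  also have "\<dots> \<le> 2" by (cases x) (auto split: instr.split simp: card_insert_if)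
  finally show ?thesis using card_enabled_le[OF assms, of a b] by simp
qed

lemma card_enabled_le_1:
  assumes "x \<in> nodes L" "x \<notin> player_nodes ins L" "\<not> cheating x (a, b)"
  shows "card (enabled_transitions (game ins L) (to_nat x, [a, b])) \<le> 1"
proof -
  have "\<exists>p. enabled_moves x a b \<subseteq> {p}"
  proof (cases x)
    case (Node l)
    then show ?thesis using assms by (cases "ins l") (auto simp: enabled_moves_def player_nodes_def nodes_def)
  next
    case (Yes l)
    then show ?thesis by (cases "ins l") (auto simp: enabled_moves_def)
  next
    case (No l)
    show ?thesis
    proof (cases "ins l")
      case (Sub c m z)
      then have "enabled_moves x a b \<subseteq> {([0, 0], Node z)}"
        using No assms by (auto simp: enabled_moves_def cheating_def split: if_splits)
      then show ?thesis by blast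
    qed (auto simp: enabled_moves_def No)
  qed (simp add: enabled_moves_def)
  then obtain p where "enabled_moves x a b \<subseteq> {p}" by blast
  then have "card (enabled_moves x a b) \<le> 1"
    using card_mono[of "{p}"] by fastforce
  then show ?thesis using card_enabled_le[OF assms(1), of a b] by simp
qed

lemma weight_game: "t \<in> transitions (game ins L) \<Longrightarrow> weight (game ins L) t = 1"
  by (simp add: game_def)

lemma outcome_confs:
  assumes "\<omega> \<in> outcome M c \<sigma>" "\<omega> n = Some d"
  obtains x a b where "d = (to_nat x, [a, b])" "x \<in> nodes L"
proof -
  have "d \<in> confs M"
  proof (cases n)
    case 0
    then show ?thesis using assms by (auto simp: outcome_def maximal_play_def)
  next
    case (Suc m)
    show ?thesis using assms(1)
      by (cases rule: outcome_Suc[of _ _ _ _ m]) (use assms Suc step_M_confs in auto)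
  qed
  then show ?thesis using that by (auto simp: confs_M)
qed

lemma next_pmf_ge_half:
  assumes "\<omega> \<in> outcome M c \<sigma>"
  shows "1 / 2 \<le> pmf (next_pmf M c \<sigma> (Suc n) \<omega>) (\<omega> (Suc n))"
proof -
  have "1 / real 2 \<le> pmf (next_pmf M c \<sigma> (Suc n) \<omega>) (\<omega> (Suc n))"
    by (rule next_pmf_ge[OF vass_mdp_game weight_game assms])
      (auto elim!: outcome_confs[OF assms] intro: card_enabled_le_2)
  then show ?thesis by simp
qed

lemma next_pmf_ge_1:
  assumes "\<omega> \<in> outcome M c \<sigma>" "\<And>x a b. \<omega> n = Some (to_nat x, [a, b]) \<Longrightarrow> \<not> cheating x (a, b)"
  shows "1 \<le> pmf (next_pmf M c \<sigma> (Suc n) \<omega>) (\<omega> (Suc n))"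
proof -
  have "card (enabled_transitions (game ins L) d) \<le> 1" if "\<omega> n = Some d" "d \<notin> player_confs M" for d
    using that outcome_confs[OF assms(1) that(1)] card_enabled_le_1 assms(2) by (metis player_confs_M)
  from next_pmf_ge[OF vass_mdp_game weight_game assms(1) order.refl this] show ?thesis by simp
qed

end

section \<open>Plays of the game and runs of the machine\<close>

context machine_game
begin

lemma machine_step_iff:
  "machine_step ins (l, v) (l', v') \<longleftrightarrow> (case ins l of
     Halt \<Rightarrow> False
   | Goto m \<Rightarrow> l' = m \<and> v' = v
   | Add c m \<Rightarrow> l' = m \<and> v' = inc c v
   | Sub c m z \<Rightarrow> if dec c v = {} then l' = z \<and> v' = v else l' = m \<and> v' \<in> dec c v)"
proof
  assume "machine_step ins (l, v) (l', v')"
  then show "case ins l of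
     Halt \<Rightarrow> False
   | Goto m \<Rightarrow> l' = m \<and> v' = v
   | Add c m \<Rightarrow> l' = m \<and> v' = inc c v
   | Sub c m z \<Rightarrow> if dec c v = {} then l' = z \<and> v' = v else l' = m \<and> v' \<in> dec c v"
    by cases auto
next
  obtain a b where v: "v = (a, b)" by force
  assume "case ins l of
     Halt \<Rightarrow> False
   | Goto m \<Rightarrow> l' = m \<and> v' = v
   | Add c m \<Rightarrow> l' = m \<and> v' = inc c v
   | Sub c m z \<Rightarrow> if dec c v = {} then l' = z \<and> v' = v else l' = m \<and> v' \<in> dec c v"
  then show "machine_step ins (l, v) (l', v')"
    unfolding v
    by (cases a; cases b) (auto intro: machine_step.intros split: instr.splits if_splits)
qed

lemma outcome_step:
  assumes "\<omega> \<in> outcome M c \<sigma>" "\<omega> n = Some (to_nat x, [a, b])"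
  obtains "\<omega> (Suc n) = None" "succs x (a, b) = {}"
  | y a' b' where "\<omega> (Suc n) = Some (to_nat y, [a', b'])" "(y, a', b') \<in> succs x (a, b)"
      "x \<in> player_nodes ins L \<Longrightarrow> (to_nat y, [a', b']) = \<sigma> (history \<omega> n)"
proof -
  have x: "x \<in> nodes L" using assms by (auto elim: outcome_confs)
  show ?thesis
    using assms(1)
  proof (cases rule: outcome_Suc[of _ _ _ _ n])
    case (2 d)
    have "succs x (a, b) = {}"
    proof (rule ccontr)
      assume "succs x (a, b) \<noteq> {}"
      then obtain y a' b' where "(y, a', b') \<in> succs x (a, b)" by (metis equals0I prod_cases3)
      then have "step M (to_nat x, [a, b]) (to_nat y, [a', b'])" using step_M_iff[OF x] by blast
      then show False using 2 assms unfolding deadlock_def by auto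
    qed
    then show ?thesis using that 2 by blast
  next
    case (3 d d')
    then obtain y a' b' where "(y, a', b') \<in> succs x (a, b)" "d' = (to_nat y, [a', b'])"
      using step_M_iff[OF x, of a b d'] assms by auto
    then show ?thesis using that(2)[of y a' b'] 3 assms player_confs_M by auto
  qed (use assms in simp)
qed

lemma measure_cylinder_1:
  assumes "w \<in> outcome M c \<sigma>"
  shows "measure (play_measure M c \<sigma>) {\<omega>. \<forall>i<Suc 0. \<omega> i = w i} = 1"
proof -
  interpret prob_space "play_measure M c \<sigma>" by (rule prob_space_play_measure)
  have "w 0 = Some c" using assms by (auto simp: outcome_def)
  then show ?thesis
    unfolding measure_play_cylinder_Suc using prob_space by simp
qed

lemma measure_singleton_ge:
  assumes w: "w \<in> outcome M c \<sigma>" and a: "\<And>n. a \<le> measure (play_measure M c \<sigma>) {\<omega>. \<forall>i<Suc n. \<omega> i = w i}"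
  shows "a \<le> measure (play_measure M c \<sigma>) {w}"
proof (rule measure_play_singleton_ge)
  interpret prob_space "play_measure M c \<sigma>" by (rule prob_space_play_measure)
  fix n
  have "measure (play_measure M c \<sigma>) {\<omega>. \<forall>i<Suc n. \<omega> i = w i} \<le> measure (play_measure M c \<sigma>) {\<omega>. \<forall>i<n. \<omega> i = w i}"
    by (intro finite_measure_mono sets_cylinder) auto
  with a[of n] show "a \<le> measure (play_measure M c \<sigma>) {\<omega>. \<forall>i<n. \<omega> i = w i}" by simp
qed

text \<open>A false claim of nonzero blocks the play, a false claim of zero is answered by the sink,
  and without false claims the play follows the run of the machine. As an outcome the losing play
  refutes sureness; its probability bounds that of the objective.\<close>

lemma cheating_player_loses:
  assumes start: "start \<in> L" and \<sigma>: "\<sigma> \<in> strategies M"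
    and unreachable: "\<And>v. \<not> (machine_step ins)\<^sup>*\<^sup>* (start, a\<^sub>0, b\<^sub>0) (accept, v)"
  defines "c \<equiv> (to_nat (Node start), [a\<^sub>0, b\<^sub>0])"
  shows "\<exists>w\<in>outcome M c \<sigma>. w \<notin> reach (to_nat (Node accept)) \<and> 1 / 2 \<le> measure (play_measure M c \<sigma>) {w}"
proof -
  \<comment> \<open>Chance enters the sink whenever some step leads there; otherwise any step will
    do.\<close>
  define pick where "pick d = (if \<exists>v. step M d (to_nat (Sink :: 'l node), v)
    then (to_nat (Sink :: 'l node), SOME v. step M d (to_nat (Sink :: 'l node), v))
    else SOME d'. step M d d')" for d
  have pick: "step M d (pick d)" if "\<not> deadlock M d" for d
  proof (cases "\<exists>v. step M d (to_nat (Sink :: 'l node), v)")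
    case True
    then show ?thesis unfolding pick_def by (simp add: someI_ex[OF True])
  next
    case False
    have "\<exists>d'. step M d d'" using that unfolding deadlock_def by blast
    then obtain d' where "step M d d'" ..
    with False show ?thesis unfolding pick_def by (simp add: someI[of "step M d" d'])
  qed
  have c: "c \<in> confs M" using start by (auto simp: c_def confs_M nodes_def)
  have "\<exists>w\<in>outcome M c \<sigma>. \<forall>n d. w n = Some d \<longrightarrow> d \<notin> player_confs M \<longrightarrow> \<not> deadlock M d \<longrightarrow>
      w (Suc n) = Some (pick d)"
    by (rule outcome_exists[OF c \<sigma>]) (erule step_M_confs, erule pick)
  then obtain w where w: "w \<in> outcome M c \<sigma>"
    and w_Suc: "\<And>n d. w n = Some d \<Longrightarrow> d \<notin> player_confs M \<Longrightarrow> \<not> deadlock M d \<Longrightarrow> w (Suc n) = Some (pick d)"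
    by blast
  define gone where "gone n \<longleftrightarrow> w n = None \<or> (\<exists>a b. w n = Some (to_nat (Sink :: 'l node), [a, b]))" for n
  have gone_Suc: "gone (Suc n)" if "gone n" for n
  proof (cases "w n")
    case None
    with w show ?thesis by (cases rule: outcome_Suc[of _ _ _ _ n]) (auto simp: gone_def)
  next
    case (Some d)
    with that obtain a b where "w n = Some (to_nat (Sink :: 'l node), [a, b])" by (auto simp: gone_def)
    with w show ?thesis by (cases rule: outcome_step) (auto simp: gone_def)
  qed
  have cheating: "gone (Suc n)" if "w n = Some (to_nat x, [a, b])" "cheating x (a, b)" for n x a b
  proof -
    from that(2) obtain l i m z where x: "x = No l" "ins l = Sub i m z" "dec i (a, b) \<noteq> {}"
      unfolding cheating_def by blast
    have "x \<in> nodes L" using w that(1) by (auto elim: outcome_confs)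
    note step = step_M_iff[OF this]
    obtain a' b' where "(a', b') \<in> dec i (a, b)" using x(3) by (metis equals0I surj_pair)
    then have "(Sink, a', b') \<in> succs x (a, b)" using x by auto
    then have "step M (to_nat x, [a, b]) (to_nat (Sink :: 'l node), [a', b'])"
      unfolding step by blast
    then have "fst (pick (to_nat x, [a, b])) = to_nat (Sink :: 'l node)" "\<not> deadlock M (to_nat x, [a, b])"
      unfolding deadlock_def by (auto simp: pick_def)
    moreover have "(to_nat x, [a, b]) \<notin> player_confs M"
      unfolding player_confs_M by (auto simp: x player_nodes_def)
    ultimately have Suc: "w (Suc n) = Some (pick (to_nat x, [a, b]))"
      and sink: "fst (pick (to_nat x, [a, b])) = to_nat (Sink :: 'l node)"
      using w_Suc that(1) by blast+
    obtain y a' b' where "pick (to_nat x, [a, b]) = (to_nat y, [a', b'])" "y \<in> nodes L"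
      using outcome_confs[OF w Suc] .
    then show ?thesis using Suc sink by (auto simp: gone_def)
  qed
  define live where "live n \<longleftrightarrow> (\<exists>l a b x. (machine_step ins)\<^sup>*\<^sup>* (start, a\<^sub>0, b\<^sub>0) (l, a, b) \<and>
    x \<in> {Node l, Yes l, No l} \<and> w n = Some (to_nat x, [a, b]))" for n
  have inv: "live n \<or> gone n" for n
  proof (induction n)
    case 0
    have "w 0 = Some c" using w by (auto simp: outcome_def)
    then show ?case unfolding live_def c_def by blast
  next
    case (Suc n)
    show ?case
    proof (cases "gone n")
      case False
      with Suc obtain l a b x where reachable: "(machine_step ins)\<^sup>*\<^sup>* (start, a\<^sub>0, b\<^sub>0) (l, a, b)"
        and x: "x \<in> {Node l, Yes l, No l}" and n: "w n = Some (to_nat x, [a, b])"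
        by (auto simp: live_def)
      have reachable_Suc: "(machine_step ins)\<^sup>*\<^sup>* (start, a\<^sub>0, b\<^sub>0) (l', v')" if "machine_step ins (l, a, b) (l', v')" for l' v'
        using reachable that by (rule rtranclp.rtrancl_into_rtrancl)
      from w n show ?thesis
      proof (cases rule: outcome_step)
        case 1
        then show ?thesis by (simp add: gone_def)
      next
        case (2 y a' b')
        show ?thesis
        proof (cases "cheating x (a, b)")
          case True
          then show ?thesis using cheating[OF n] by blast
        next
          case False
          have "\<exists>l'. (machine_step ins)\<^sup>*\<^sup>* (start, a\<^sub>0, b\<^sub>0) (l', a', b') \<and> y \<in> {Node l', Yes l', No l'}"
          proof (cases "ins l")
            case (Sub i m z)
            show ?thesis
            proof (cases "dec i (a, b) = {}")
              case True
              \<comment> \<open>With the counter at zero, \<open>Yes l\<close> has no successor and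
                \<open>No l\<close> proceeds as the machine does.\<close>
              then have "machine_step ins (l, a, b) (z, a, b)" using Sub by (simp add: machine_step_iff)
              from reachable_Suc[OF this] show ?thesis
                using x 2(2) Sub True reachable by (auto simp del: dec.simps)
            next
              case dec: False
              then have "x \<noteq> No l" using False Sub by (auto simp: cheating_def simp del: dec.simps)
              moreover have "machine_step ins (l, a, b) (m, a', b')" if "(a', b') \<in> dec i (a, b)"
                using Sub that by (auto simp: machine_step_iff simp del: dec.simps)
              ultimately show ?thesis
                using x 2(2) Sub reachable reachable_Suc by (auto simp del: dec.simps)
            qed
          qed (use x 2(2) reachable reachable_Suc in \<open>auto simp: machine_step_iff simp del: inc.simps\<close>)
          then show ?thesis unfolding live_def using 2(1) by blast
        qed
      qed
    qed (use gone_Suc in blast)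
  qed
  have "w \<notin> reach (to_nat (Node accept))"
  proof
    assume "w \<in> reach (to_nat (Node accept))"
    then obtain n v where n: "w n = Some (to_nat (Node accept), v)" by (auto simp: reach_def)
    then have "\<not> gone n" by (auto simp: gone_def)
    with inv[of n] n show False using unreachable by (auto simp: live_def)
  qed
  moreover have "1 / 2 \<le> measure (play_measure M c \<sigma>) {w}"
  proof (rule measure_singleton_ge[OF w])
    let ?cyl = "\<lambda>n. measure (play_measure M c \<sigma>) {\<omega>. \<forall>i<n. \<omega> i = w i}"
    let ?p = "\<lambda>n. pmf (next_pmf M c \<sigma> n w) (w n)"
    txt \<open>The factor 1/2 occurs at most once, since the play ends once it has entered the sink.\<close>
    have bound: "1 \<le> ?cyl (Suc n) \<or> (1 / 2 \<le> ?cyl (Suc n) \<and> gone n)" for n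
    proof (induction n)
      case 0
      then show ?case using measure_cylinder_1[OF w] by simp
    next
      case (Suc n)
      have p: "1 / 2 \<le> ?p (Suc n)" by (rule next_pmf_ge_half[OF w])
      show ?case
      proof (cases "\<exists>x a b. w n = Some (to_nat x, [a, b]) \<and> cheating x (a, b)")
        case True
        then obtain x a b where x: "w n = Some (to_nat x, [a, b])" "cheating x (a, b)" by blast
        then have "gone (Suc n)" by (rule cheating)
        have "x \<noteq> Sink" using x(2) by (auto simp: cheating_def)
        with x(1) have "\<not> gone n" by (auto simp: gone_def)
        with Suc have "1 \<le> ?cyl (Suc n)" by blast
        then have "1 * (1 / 2) \<le> ?cyl (Suc n) * ?p (Suc n)" using p by (intro mult_mono) auto
        then show ?thesis using \<open>gone (Suc n)\<close> unfolding measure_play_cylinder_Suc[where n = "Suc n"] by simp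
      next
        case False
        then have "1 \<le> ?p (Suc n)" using next_pmf_ge_1[OF w] by blast
        then have "?cyl (Suc n) * 1 \<le> ?cyl (Suc n) * ?p (Suc n)" by (intro mult_left_mono) auto
        then have "?cyl (Suc n) \<le> ?cyl (Suc (Suc n))" unfolding measure_play_cylinder_Suc[where n = "Suc n"] by simp
        then show ?thesis using Suc gone_Suc[of n] by linarith
      qed
    qed
    show "1 / 2 \<le> ?cyl (Suc n)" for n using bound[of n] by linarith
  qed
  ultimately show ?thesis using w by blast
qed

text \<open>Positional, with the node recovered from its code by \<open>from_nat\<close>. The
  undefined values occur only at nodes that do not belong to Player 1.\<close>

definition honest :: "nat config list \<Rightarrow> nat config" where
  "honest h = (case last h of (q, v) \<Rightarrow> case from_nat q :: 'l node of
     Node l \<Rightarrow> (case ins l of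
       Sub c m z \<Rightarrow> (to_nat (if dec c (v ! 0, v ! 1) = {} then No l else Yes l), v)
     | _ \<Rightarrow> undefined)
   | _ \<Rightarrow> undefined)"

lemma honest_Sub:
  "last h = (to_nat (Node l), [a, b]) \<Longrightarrow> ins l = Sub c m z \<Longrightarrow>
    honest h = (to_nat (if dec c (a, b) = {} then No l else Yes l), [a, b])"
  by (simp add: honest_def)

lemma honest_strategy: "honest \<in> strategies M"
proof -
  have "step M (last h) (honest h)" if h: "finite_play M h" "last h \<in> player_confs M" for h
  proof -
    have "last h \<in> confs M" using h by (auto simp: finite_play_def)
    then obtain x a b where x: "last h = (to_nat x, [a, b])" "x \<in> nodes L" by (auto simp: confs_M)
    then have "x \<in> player_nodes ins L" using h(2) player_confs_M by simp
    then obtain l c m z where l: "x = Node l" "ins l = Sub c m z" by (auto simp: player_nodes_def)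
    then show ?thesis
      using honest_Sub[of h l a b c m z] x step_M_iff[OF x(2), of a b] by simp
  qed
  then show ?thesis by (simp add: strategies_def)
qed

text \<open>All outcomes follow the run of the machine into the accepting self-loop. No false claim
  occurs, so each step has probability 1 and a single play carries the whole measure.\<close>

lemma honest_player_wins:
  assumes start: "start \<in> L" and accept: "ins accept = Goto accept"
    and reachable: "(machine_step ins)\<^sup>*\<^sup>* (start, a\<^sub>0, b\<^sub>0) (accept, v)"
  defines "c \<equiv> (to_nat (Node start), [a\<^sub>0, b\<^sub>0])"
  shows "outcome M c honest \<subseteq> repeated_reach (to_nat (Node accept))"
    and "\<exists>w\<in>outcome M c honest. 1 \<le> measure (play_measure M c honest) {w}"
proof -
  have honest: "\<omega> (Suc n) = Some (to_nat (if dec i (a, b) = {} then No l else Yes l), [a, b])"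
    if \<omega>: "\<omega> \<in> outcome M c honest" "\<omega> n = Some (to_nat (Node l), [a, b])" "ins l = Sub i m z" for \<omega> n l a b i m z
  proof -
    have "Node l \<in> nodes L" using \<omega> by (auto elim!: outcome_confs)
    then have player: "Node l \<in> player_nodes ins L"
      using \<omega>(3) by (auto simp: nodes_def player_nodes_def)
    from \<omega>(1,2) show ?thesis
    proof (cases rule: outcome_step)
      case 1
      then show ?thesis using \<omega>(3) by simp
    next
      case (2 y a' b')
      have "last (history \<omega> n) = (to_nat (Node l), [a, b])" using \<omega>(2) by (simp add: last_history)
      from honest_Sub[OF this \<omega>(3)] 2(1) 2(3)[OF player] show ?thesis by metis
    qed
  qed
  show "outcome M c honest \<subseteq> repeated_reach (to_nat (Node accept))"
  proof
    fix \<omega> assume \<omega>: "\<omega> \<in> outcome M c honest"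
    \<comment> \<open>The index \<open>n'\<close> is left open, since a zero test takes two steps of
      the play and any other instruction one.\<close>
    have advance: "\<exists>n'. \<omega> n' = Some (to_nat (Node l'), [a', b'])"
      if "machine_step ins (l, a, b) (l', a', b')" "\<omega> n = Some (to_nat (Node l), [a, b])" for n l a b l' a' b'
    proof (cases "\<exists>i m z. ins l = Sub i m z")
      case False
      from \<omega> that(2) show ?thesis
        by (cases rule: outcome_step)
          (use that(1) False in \<open>auto simp: machine_step_iff split: instr.splits if_splits\<close>)
    next
      case True
      then obtain i m z where ins: "ins l = Sub i m z" by blast
      note Suc = honest[OF \<omega> that(2) ins]
      from \<omega> Suc show ?thesis
        by (cases rule: outcome_step)
          (use that(1) ins in \<open>auto simp: machine_step_iff split: if_splits\<close>)
    qed
    have "\<exists>n. \<omega> n = Some (to_nat (Node l), [a, b])"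
      if "(machine_step ins)\<^sup>*\<^sup>* (start, a\<^sub>0, b\<^sub>0) (l, a, b)" for l a b
      using that
    proof (induction "(l, a, b)" arbitrary: l a b rule: rtranclp_induct)
      case base
      then show ?case using \<omega> by (auto simp: outcome_def c_def)
    next
      case (step y)
      then show ?case using advance by (cases y) blast
    qed
    then obtain n a b where n: "\<omega> n = Some (to_nat (Node accept), [a, b])"
      using reachable by (cases v) blast
    have stay: "\<omega> (n + i) = Some (to_nat (Node accept), [a, b])" for i
    proof (induction i)
      case (Suc i)
      with \<omega> show ?case by (cases rule: outcome_step) (auto simp: accept)
    qed (simp add: n)
    have "\<omega> i \<noteq> None" for i
    proof
      assume None: "\<omega> i = None"
      have "\<omega> (i + j) = None" for j
      proof (induction j)
        case (Suc j)
        with \<omega> show ?case by (cases rule: outcome_Suc[of _ _ _ _ "i + j"]) auto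
      qed (simp add: None)
      from this[of n] stay[of i] show False by (simp add: add.commute)
    qed
    moreover have "\<exists>i\<ge>k. \<exists>v. \<omega> i = Some (to_nat (Node accept), v)" for k
      using stay[of k] by (intro exI[of _ "n + k"]) auto
    ultimately show "\<omega> \<in> repeated_reach (to_nat (Node accept))" by (auto simp: repeated_reach_def)
  qed
  have c: "c \<in> confs M" using start by (auto simp: c_def confs_M nodes_def)
  have pick: "step M d (SOME d'. step M d d')" if "\<not> deadlock M d" for d
    using that unfolding deadlock_def by (metis someI_ex)
  obtain w where w: "w \<in> outcome M c honest"
    using outcome_exists[OF c honest_strategy _ pick] step_M_confs by blast
  \<comment> \<open>A node \<open>No l\<close> is entered only from \<open>Node l\<close> with the
    same counters, where the honest strategy has just found the counter to be zero.\<close>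
  have no_cheating: "\<not> cheating x (a, b)" if n: "w n = Some (to_nat x, [a, b])" for n x a b
  proof (cases n)
    case 0
    then have "x = Node start" using w n by (auto simp: outcome_def c_def)
    then show ?thesis by (simp add: cheating_def)
  next
    case (Suc k)
    show ?thesis
    proof
      assume "cheating x (a, b)"
      then obtain l i m z where x: "x = No l" "ins l = Sub i m z" "dec i (a, b) \<noteq> {}"
        unfolding cheating_def by blast
      from w obtain d where "w k = Some d"
        by (cases rule: outcome_Suc[of _ _ _ _ k]) (use Suc n in auto)
      from outcome_confs[OF w this] obtain y a' b' where "d = (to_nat y, [a', b'])" "y \<in> nodes L" .
      with \<open>w k = Some d\<close> have k: "w k = Some (to_nat y, [a', b'])" by simp
      from w k have "(No l, a, b) \<in> succs y (a', b')"
        by (cases rule: outcome_step) (use Suc n x in auto)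
      then have "y = Node l" "a' = a" "b' = b"
        by (cases y; auto split: instr.splits if_splits)+
      with honest[OF w _ x(2)] k n Suc x show False by auto
    qed
  qed
  have "1 \<le> measure (play_measure M c honest) {w}"
  proof (rule measure_singleton_ge[OF w])
    fix n
    show "1 \<le> measure (play_measure M c honest) {\<omega>. \<forall>i<Suc n. \<omega> i = w i}"
    proof (induction n)
      case 0
      then show ?case using measure_cylinder_1[OF w] by simp
    next
      case (Suc n)
      have "1 \<le> pmf (next_pmf M c honest (Suc n) w) (w (Suc n))"
        using next_pmf_ge_1[OF w no_cheating] .
      then have "1 * 1 \<le> measure (play_measure M c honest) {\<omega>. \<forall>i<Suc n. \<omega> i = w i} * pmf (next_pmf M c honest (Suc n) w) (w (Suc n))"
        using Suc by (intro mult_mono) auto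
      then show ?case unfolding measure_play_cylinder_Suc[where n = "Suc n"] by simp
    qed
  qed
  with w show "\<exists>w\<in>outcome M c honest. 1 \<le> measure (play_measure M c honest) {w}" by blast
qed

text \<open>Since \<open>repeated_reach\<close> is contained in \<open>reach\<close>, it suffices
  that a win meets the harder objective and a loss misses the easier one.\<close>

theorem game_correct:
  fixes a\<^sub>0 b\<^sub>0 :: nat
  assumes start: "start \<in> L" and accept: "ins accept = Goto accept"
    and X: "X = reach (to_nat (Node accept)) \<or> X = repeated_reach (to_nat (Node accept))"
  defines "c \<equiv> (to_nat (Node start), [a\<^sub>0, b\<^sub>0])"
    and "R \<equiv> \<exists>v. (machine_step ins)\<^sup>*\<^sup>* (start, a\<^sub>0, b\<^sub>0) (accept, v)"
  shows "sure M c X \<longleftrightarrow> R" "almost_sure M c X \<longleftrightarrow> R" "limit_sure M c X \<longleftrightarrow> R"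
proof -
  have rep: "repeated_reach q \<subseteq> reach q" for q :: nat
    unfolding repeated_reach_def reach_def by blast
  have sets: "X \<in> sets (play_measure M c \<sigma>)" for \<sigma>
    using X sets_reach sets_repeated_reach by blast
  have le_1: "measure (play_measure M c \<sigma>) X \<le> 1" for \<sigma>
    using prob_space.prob_le_1[OF prob_space_play_measure] .
  have yes: "sure M c X \<and> almost_sure M c X \<and> limit_sure M c X" if R
  proof -
    from that obtain v where "(machine_step ins)\<^sup>*\<^sup>* (start, a\<^sub>0, b\<^sub>0) (accept, v)" by (auto simp: R_def)
    note win = honest_player_wins[OF start accept this, folded c_def]
    have sub: "outcome M c honest \<subseteq> X" using win(1) X rep by blast
    obtain w where w: "w \<in> outcome M c honest" "1 \<le> measure (play_measure M c honest) {w}"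
      using win(2) by blast
    interpret prob_space "play_measure M c honest" by (rule prob_space_play_measure)
    have "measure (play_measure M c honest) {w} \<le> measure (play_measure M c honest) X"
      using sub w(1) by (intro finite_measure_mono sets) auto
    then have 1: "measure (play_measure M c honest) X = 1" using w(2) le_1[of honest] by linarith
    have "limit_sure M c X"
      unfolding limit_sure_def
      by (rule cSup_eq_maximum) (use 1 honest_strategy le_1 in \<open>auto intro: image_eqI[of _ _ honest]\<close>)
    then show ?thesis using 1 sub honest_strategy by (auto simp: sure_def almost_sure_def)
  qed
  have no: "\<not> sure M c X \<and> \<not> almost_sure M c X \<and> \<not> limit_sure M c X" if "\<not> R"
  proof -
    have lose: "\<exists>w\<in>outcome M c \<sigma>. w \<notin> X \<and> 1 / 2 \<le> measure (play_measure M c \<sigma>) {w}" if "\<sigma> \<in> strategies M" for \<sigma>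
      using cheating_player_loses[OF start that, of a\<^sub>0 b\<^sub>0 accept] \<open>\<not> R\<close> X rep unfolding R_def c_def by blast
    have half: "measure (play_measure M c \<sigma>) X \<le> 1 / 2" if "\<sigma> \<in> strategies M" for \<sigma>
    proof -
      interpret prob_space "play_measure M c \<sigma>" by (rule prob_space_play_measure)
      obtain w where w: "w \<notin> X" "1 / 2 \<le> measure (play_measure M c \<sigma>) {w}"
        using lose[OF \<open>\<sigma> \<in> strategies M\<close>] by blast
      have "measure (play_measure M c \<sigma>) (X \<union> {w}) = measure (play_measure M c \<sigma>) X + measure (play_measure M c \<sigma>) {w}"
        using w by (intro finite_measure_Union sets sets_play_singleton) auto
      then show ?thesis using w(2) prob_le_1[of "X \<union> {w}"] by linarith
    qed
    \<comment> \<open>Here \<open>honest_strategy\<close> shows that the supremum is over a nonempty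
      set.\<close>
    have "(SUP \<sigma>\<in>strategies M. measure (play_measure M c \<sigma>) X) \<le> 1 / 2"
      using honest_strategy half by (intro cSUP_least) auto
    then show ?thesis
      using lose half by (fastforce simp: sure_def almost_sure_def limit_sure_def)
  qed
  show "sure M c X \<longleftrightarrow> R" "almost_sure M c X \<longleftrightarrow> R" "limit_sure M c X \<longleftrightarrow> R"
    using yes no by blast+
qed

end

lemma machine_game_program: "machine_game (program p) (labels p)"
  using finite_labels targets_program by unfold_locales

section \<open>Diagonalization\<close>

text \<open>The two control states have the same codes for every \<open>p\<close>, so the code of
  the instance depends on \<open>p\<close> only through that of the VASS.\<close>

definition program_instance :: "op list \<Rightarrow> nat \<Rightarrow> vass_instance" where
  "program_instance p x = (game (program p) (labels p), (to_nat (Node Start), [2 ^ x, 0]), to_nat (Node (Fwd 0 [])))"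

definition accepts :: "op list \<Rightarrow> nat \<Rightarrow> bool" where
  "accepts p x \<longleftrightarrow> (\<exists>v. program_steps p (Start, 2 ^ x, 0) (Fwd 0 [], v))"

lemma Start_in_labels: "Start \<in> labels p"
  by (simp add: labels_def)

lemma accept_in_labels: "Fwd 0 [] \<in> labels p"
  using end_in_stacks[of "[]" p] by (auto simp: labels_def)

lemma program_instance_correct:
  shows "sure_reachability 2 (program_instance p x) \<longleftrightarrow> accepts p x"
    and "almost_sure_reachability 2 (program_instance p x) \<longleftrightarrow> accepts p x"
    and "limit_sure_reachability 2 (program_instance p x) \<longleftrightarrow> accepts p x"
    and "sure_repeated_reachability 2 (program_instance p x) \<longleftrightarrow> accepts p x"
    and "almost_sure_repeated_reachability 2 (program_instance p x) \<longleftrightarrow> accepts p x"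
    and "limit_sure_repeated_reachability 2 (program_instance p x) \<longleftrightarrow> accepts p x"
  unfolding program_instance_def accepts_def
  by (simp_all add: machine_game.game_correct[OF machine_game_program Start_in_labels] del: split_paired_Ex)

lemma program_instance_in_instances: "program_instance p x \<in> p_vass_instances 2"
proof -
  interpret machine_game "program p" "labels p" by (rule machine_game_program)
  have "states (game (program p) (labels p)) = to_nat ` nodes (labels p)"
    by (simp add: game_def)
  then show ?thesis
    using p_vass_mdp_game Start_in_labels[of p] accept_in_labels[of p]
    by (auto simp: program_instance_def p_vass_instances_def confs_M nodes_def)
qed

lemma godel_initial: "godel ((\<lambda>_. 0)(0 := x)) (2 ^ x)"
proof -
  have "multiplicity (register_prime r) (2 ^ x) = (if r = 0 then x else 0)" for r
  proof (cases "r = 0")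
    case True
    then show ?thesis using multiplicity_same_power[of 2 x] by (simp add: pr_0)
  next
    case False
    then have "\<not> register_prime r dvd 2 ^ x"
      using prime_dvd_power[OF prime_pr] primes_dvd_imp_eq[OF prime_pr two_is_prime_nat] pr_eq_iff[of r 0]
      by (auto simp: pr_0)
    then show ?thesis using False by (simp add: not_dvd_imp_multiplicity_0)
  qed
  then show ?thesis by (auto simp: godel_def)
qed

text \<open>The argument is used twice, by \<open>Proj 0\<close> as the code of the VASS and by
  \<open>power_recf\<close> as the exponent of the initial counter. This is the self-application of
  the diagonal argument.\<close>

definition instance_recf :: recf where
  "instance_recf = list_recf [Proj 0, const_recf (to_nat (Node Start)),
     list_recf [power_recf, Zero], const_recf (to_nat (Node (Fwd 0 [])))]"

lemma evals_to_instance_recf: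
  "evals_to instance_recf [vass_code (game (program p) (labels p))]
    (instance_code (program_instance p (vass_code (game (program p) (labels p)))))"
  unfolding instance_recf_def program_instance_def instance_code.simps
  by (intro evals_to_list list_all2_Cons[THEN iffD2] conjI evals_to_const evals_to_power evals_to.Zero evals_to_Proj) auto

text \<open>Stated for any \<open>P\<close> that means acceptance on program instances, so that it
  applies to all six problems.\<close>

lemma not_decidable:
  assumes P: "\<And>p x. P (program_instance p x) \<longleftrightarrow> accepts p x"
  shows "\<not> decidable instance_code (p_vass_instances 2) P"
proof
  assume "decidable instance_code (p_vass_instances 2) P"
  then obtain f where f: "\<And>I. I \<in> p_vass_instances 2 \<Longrightarrow> evals_to f [instance_code I] (if P I then 1 else 0)"
    by (auto simp: decidable_def)
  define g where "g = Comp f [instance_recf]"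
  \<comment> \<open>Register 0 holds the input, register 1 the answer, and scratch space starts at
    2. The final loop falls through to the accepting empty stack on answer 0 and runs into
    \<open>Stop\<close> otherwise.\<close>
  define p where "p = compile g [0] 1 2 @ [Loop 1 [Stop]]"
  \<comment> \<open>\<open>p\<close> does not depend on \<open>x\<close>, so it may be fed the code
    of its own VASS.\<close>
  define x where "x = vass_code (game (program p) (labels p))"
  define y :: nat where "y = (if accepts p x then 1 else 0)"
  have "evals_to f [instance_code (program_instance p x)] y"
    using f[OF program_instance_in_instances] by (simp add: y_def P)
  then have g: "evals_to g [x] y"
    unfolding g_def x_def by (rule evals_to_Comp1[OF evals_to_instance_recf])
  let ?s = "(\<lambda>_. 0)(0 := x)"
  have "exec (compile g [0] 1 2) ?s (?s(1 := y))"
    by (rule exec_compile) (use g in auto)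
  then have run: "op_step\<^sup>*\<^sup>* (p, ?s) ([Loop 1 [Stop]], ?s(1 := y))"
    by (simp only: exec_def p_def)
  have start: "program_steps p (Start, 2 ^ x, 0) (Fwd 0 p, 2 ^ x, 0)"
    by (rule r_into_rtranclp, rule machine_step.Goto) simp
  show False
  proof (cases "accepts p x")
    case True
    have "op_step ([Loop 1 [Stop]], ?s(1 := y)) ([Stop] @ [Loop 1 [Stop]], (?s(1 := y))(1 := 0))"
      by (rule op_step.Loop_Suc) (use True in \<open>simp add: y_def\<close>)
    with run have "op_step\<^sup>*\<^sup>* (p, ?s) ([Stop, Loop 1 [Stop]], (?s(1 := y))(1 := 0))"
      by (auto intro: rtranclp.rtrancl_into_rtrancl)
    from program_simulates[OF this godel_initial]
    obtain N where "program_steps p (Fwd 0 p, 2 ^ x, 0) (Fwd 0 [Stop, Loop 1 [Stop]], N, 0)" by blast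
    with start have halt: "program_steps p (Start, 2 ^ x, 0) (Fwd 0 [Stop, Loop 1 [Stop]], N, 0)"
      by (rule rtranclp_trans)
    from True obtain a b where acc: "program_steps p (Start, 2 ^ x, 0) (Fwd 0 [], a, b)"
      by (auto simp: accepts_def)
    have "\<not> machine_step (program p) (Fwd 0 [Stop, Loop 1 [Stop]], N, 0) d" for d
      by (auto elim: machine_step.cases)
    from machine_steps_to_halted[OF halt acc this]
    have "program_steps p (Fwd 0 [], a, b) (Fwd 0 [Stop, Loop 1 [Stop]], N, 0)" .
    \<comment> \<open>The accepting label is never left, so it cannot occur on a run that gets stuck
      at \<open>Stop\<close>.\<close>
    moreover have "fst d = Fwd 0 []" if "program_steps p (Fwd 0 [], a, b) d" for d
      using that by induction (auto elim: machine_step.cases)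
    ultimately show False by fastforce
  next
    case False
    have "op_step ([Loop 1 [Stop]], ?s(1 := y)) ([], ?s(1 := y))"
      by (rule op_step.Loop_0) (use False in \<open>simp add: y_def\<close>)
    with run have "op_step\<^sup>*\<^sup>* (p, ?s) ([], ?s(1 := y))"
      by (rule rtranclp.rtrancl_into_rtrancl)
    from program_simulates[OF this godel_initial]
    obtain N where "program_steps p (Fwd 0 p, 2 ^ x, 0) (Fwd 0 [], N, 0)" by blast
    with start have "accepts p x" unfolding accepts_def by (meson rtranclp_trans)
    with False show False by contradiction
  qed
qed

theorem theorem3:
  shows "\<not> decidable instance_code (p_vass_instances 2) (sure_reachability 2) \<and>
    \<not> decidable instance_code (p_vass_instances 2) (almost_sure_reachability 2) \<and>
    \<not> decidable instance_code (p_vass_instances 2) (limit_sure_reachability 2) \<and>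
    \<not> decidable instance_code (p_vass_instances 2) (sure_repeated_reachability 2) \<and>
    \<not> decidable instance_code (p_vass_instances 2) (almost_sure_repeated_reachability 2) \<and>
    \<not> decidable instance_code (p_vass_instances 2) (limit_sure_repeated_reachability 2)"
  by (intro conjI not_decidable program_instance_correct)

end
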